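(* Let $\alpha$ and $\beta$ be fixed partitions. Then, as a function of the integer $k$ (for $k$ at least the number of parts of $\alpha$ and of $\beta$), $N_k(\alpha;\beta)$ is a polynomial in $k$ of degree at most $2(|\alpha|+|\beta|)$.
   Context: A partition with at most $k$ parts is identified with the nonincreasing $k$-tuple of nonnegative integers obtained by padding with zeros; $|\alpha|=\sum_i\alpha_i$. $\tilde M_k$: for $k$-tuples $a=(a_1,\dots,a_k)$, $b=(b_1,\dots,b_k)$ of nonnegative integers, $\tilde M_k(a,b)=(-1)^{\sum_i b_i}\det(m_{ij})_{1\le i,j\le 2k}$, where for $1\le i\le k$, $1\le j\le 2k$: $m_{ij}=\Gamma(2k-i-j+2-a_i)^{-1}$ and $m_{k+i,j}=(-1)^{i+j-1}\Gamma(2k-i-j+2-b_i)^{-1}$, with the convention $1/\Gamma(m)=0$ for $m\in\{0,-1,-2,\dots\}$. $N_k$: with $r=|\alpha|+|\beta|$, $$N_k(\alpha;\beta)=\frac{1}{2^{k^2-r}}\Bigl(\prod_{l=0}^{k-1}\frac{l!}{(k+l)!}\Bigr)^{-1}\sum_{\sigma(\alpha),\tau(\beta)}\tilde M_k(\sigma(\alpha),\tau(\beta)),$$ where the sum runs over all distinct rearrangements $\sigma(\alpha)=(\alpha_{\sigma_1},\dots,\alpha_{\sigma_k})$ of the $k$-tuple $\alpha$ and $\tau(\beta)$ of $\beta$ (two rearrangements are the same if they give the same $k$-tuple). *)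

theory Defs
  imports "HOL-Analysis.Gamma_Function" "HOL-Combinatorics.Multiset_Permutations"
    "Jordan_Normal_Form.Determinant" "HOL-Computational_Algebra.Polynomial"
begin

definition is_partition :: "nat list \<Rightarrow> bool" where
  "is_partition xs \<longleftrightarrow> sorted_wrt (\<ge>) xs \<and> 0 \<notin> set xs"

definition pad :: "nat \<Rightarrow> nat list \<Rightarrow> nat list" where
  "pad k xs = xs @ replicate (k - length xs) 0"

(* The 2k x 2k matrix (m_ij), 0-indexed: row i<k corresponds to row i+1 in the paper,
   row k+i to row k+i+1, column j to column j+1. *)
definition Mmat :: "nat \<Rightarrow> nat list \<Rightarrow> nat list \<Rightarrow> real mat" where
  "Mmat k a b = mat (2*k) (2*k) (\<lambda>(i,j).
     if i < k then
       rGamma (of_int (2*int k - int (i+1) - int (j+1) + 2 - int (a ! i)))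
     else
       (-1) ^ ((i-k+1) + (j+1) - 1) *
       rGamma (of_int (2*int k - int (i-k+1) - int (j+1) + 2 - int (b ! (i-k)))))"

definition Mtilde :: "nat \<Rightarrow> nat list \<Rightarrow> nat list \<Rightarrow> real" where
  "Mtilde k a b = (-1) ^ (sum_list b) * Determinant.det (Mmat k a b)"

definition N :: "nat \<Rightarrow> nat list \<Rightarrow> nat list \<Rightarrow> real" where
  "N k \<alpha> \<beta> =
     (let r = sum_list \<alpha> + sum_list \<beta> in
      1 / (2::real) powi (int (k^2) - int r)
      * inverse (\<Prod>l<k. fact l / fact (k + l))
      * (\<Sum>s\<in>permutations_of_multiset (mset (pad k \<alpha>)).
           \<Sum>t\<in>permutations_of_multiset (mset (pad k \<beta>)). Mtilde k s t))"

end

theory Submission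
  imports Defs
begin

text \<open>
  Reading a column index \<open>j\<close> as the power \<open>2k - 1 - j\<close> of \<open>z\<close>, the signed determinant is the
  determinant of the polynomials \<open>z^(i + a i) exp z\<close> and \<open>z^(i + b i) exp (-z)\<close>, \<open>i < k\<close>, modulo
  \<open>z^(2k)\<close>. Summing over rearrangements amounts to letting monomial symmetric functions act on the
  exponents of each half, and monomial symmetric functions are combinations of products of power
  sums with coefficients that do not depend on \<open>k\<close>. Write \<open>P r\<close> and \<open>Q r\<close> for the action of the
  \<open>r\<close>-th power sum on the two halves. Multiplication by \<open>z^r\<close> is nilpotent, so \<open>P r + Q r = 0\<close> for
  \<open>r \<ge> 1\<close> and only power sums on the first half matter. The derivation \<open>z^(m + 1) d/dz\<close> has known
  trace, which at the staircase exponents yields loop equations: \<open>2 P 1\<close> acts on an element of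
  weight \<open>w\<close> as the scalar \<open>k^2 - w\<close>, and \<open>2 P (m + 1) F\<close> equals, up to sign, the sum of
  \<open>P a (P (m - a) F)\<close> over \<open>0 < a < m\<close> plus the terms obtained by raising by \<open>m\<close> one of the parts
  in \<open>F\<close>. Each such step lowers the weight by one and raises the degree in \<open>k\<close> by at most two.
  The value without shifts is the normalising constant of \<open>N\<close>.
\<close>

section \<open>Power sums acting on exponents\<close>

definition shift :: "nat \<Rightarrow> nat \<Rightarrow> (nat \<Rightarrow> nat) \<Rightarrow> nat \<Rightarrow> nat" where
  "shift i r n = n(i := n i + r)"

lemma shift_0 [simp]: "shift i 0 n = n"
  by (simp add: shift_def)

lemma shift_apply: "shift i r n j = n j + (if j = i then r else 0)"
  by (simp add: shift_def)

lemma shift_commute: "shift i r (shift j s n) = shift j s (shift i r n)"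
  by (auto simp: shift_def fun_eq_iff)

lemma shift_shift_same [simp]: "shift i r (shift i s n) = shift i (s + r) n"
  by (auto simp: shift_def fun_eq_iff)

definition psum :: "nat set \<Rightarrow> nat \<Rightarrow> ((nat \<Rightarrow> nat) \<Rightarrow> real) \<Rightarrow> (nat \<Rightarrow> nat) \<Rightarrow> real" where
  "psum S r \<Phi> n = (\<Sum>i\<in>S. \<Phi> (shift i r n))"

abbreviation pw :: "nat set \<Rightarrow> nat list \<Rightarrow> ((nat \<Rightarrow> nat) \<Rightarrow> real) \<Rightarrow> (nat \<Rightarrow> nat) \<Rightarrow> real" where
  "pw S ls \<Phi> \<equiv> foldr (psum S) ls \<Phi>"

lemma psum_commute: "psum S r (psum T s \<Phi>) = psum T s (psum S r \<Phi>)"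
proof
  fix n
  have "psum S r (psum T s \<Phi>) n = (\<Sum>i\<in>S. \<Sum>j\<in>T. \<Phi> (shift j s (shift i r n)))"
    by (simp add: psum_def)
  also have "\<dots> = (\<Sum>j\<in>T. \<Sum>i\<in>S. \<Phi> (shift i r (shift j s n)))"
    by (subst sum.swap) (simp add: shift_commute)
  finally show "psum S r (psum T s \<Phi>) n = psum T s (psum S r \<Phi>) n"
    by (simp add: psum_def)
qed

lemma psum_pw_commute: "psum T s (pw S ls \<Phi>) = pw S ls (psum T s \<Phi>)"
  by (induction ls) (simp_all add: psum_commute[of T s S _ "foldr _ _ _"])

lemma psum_0: "psum S 0 \<Phi> n = real (card S) * \<Phi> n"
  by (simp add: psum_def)

lemma psum_uminus: "psum S r (\<lambda>n. - \<Phi> n) = (\<lambda>n. - psum S r \<Phi> n)"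
  by (auto simp: psum_def sum_negf)

section \<open>Functions antisymmetric in the exponents, and the staircase\<close>

definition alternating_on :: "nat set \<Rightarrow> ((nat \<Rightarrow> nat) \<Rightarrow> real) \<Rightarrow> bool" where
  "alternating_on S \<Phi> \<longleftrightarrow>
     (\<forall>i\<in>S. \<forall>j\<in>S. i \<noteq> j \<longrightarrow> (\<forall>n. \<Phi> (n \<circ> Transposition.transpose i j) = - \<Phi> n))"

lemma alternating_onD:
  "alternating_on S \<Phi> \<Longrightarrow> i \<in> S \<Longrightarrow> j \<in> S \<Longrightarrow> i \<noteq> j \<Longrightarrow> \<Phi> (n \<circ> Transposition.transpose i j) = - \<Phi> n"
  by (auto simp: alternating_on_def)

lemma alternating_on_eq_0:
  assumes "alternating_on S \<Phi>" "i \<in> S" "j \<in> S" "i \<noteq> j" "n i = n j"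
  shows "\<Phi> n = 0"
proof -
  have "n \<circ> Transposition.transpose i j = n"
    using assms(5) by (auto simp: fun_eq_iff Transposition.transpose_def)
  with alternating_onD[OF assms(1-4), of n] show ?thesis by simp
qed

text \<open>A transposition of two indices of \<open>S\<close> maps \<open>T\<close> to itself,
  because \<open>T\<close> contains both of them or neither; so it merely permutes the terms of the
  power sum.\<close>

lemma alternating_on_psum:
  assumes "alternating_on S \<Phi>" and "S \<subseteq> T \<or> S \<inter> T = {}"
  shows "alternating_on S (psum T r \<Phi>)"
  unfolding alternating_on_def
proof (intro ballI impI allI)
  fix i j n assume ij: "i \<in> S" "j \<in> S" "i \<noteq> j"
  let ?t = "Transposition.transpose i j"
  have sh: "shift l r (n \<circ> ?t) = shift (?t l) r n \<circ> ?t" for l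
    by (auto simp: fun_eq_iff shift_def Transposition.transpose_def)
  have "psum T r \<Phi> (n \<circ> ?t) = - (\<Sum>l\<in>T. \<Phi> (shift (?t l) r n))"
    unfolding psum_def sh by (simp add: alternating_onD[OF assms(1) ij] sum_negf)
  also have "(\<Sum>l\<in>T. \<Phi> (shift (?t l) r n)) = (\<Sum>l\<in>T. \<Phi> (shift l r n))"
  proof (rule sum.reindex_bij_witness[of _ ?t ?t])
    show "?t l \<in> T" if "l \<in> T" for l
      using that ij assms(2) by (auto simp: Transposition.transpose_def)
    show "?t l \<in> T" if "l \<in> T" for l
      using that ij assms(2) by (auto simp: Transposition.transpose_def)
  qed (auto simp: transpose_involutory)
  finally show "psum T r \<Phi> (n \<circ> ?t) = - psum T r \<Phi> n"
    unfolding psum_def .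
qed

lemma alternating_on_pw:
  assumes "alternating_on S \<Phi>" and "S \<subseteq> T \<or> S \<inter> T = {}"
  shows "alternating_on S (pw T ls \<Phi>)"
  by (induction ls) (simp_all add: assms(1) alternating_on_psum[OF _ assms(2)])

text \<open>Since the exponents strictly between \<open>n i\<close> and \<open>n j\<close> are occupied, raising \<open>n i\<close> by
  \<open>a\<close> contributes nothing for \<open>0 < a < n j - n i\<close>, and the terms with \<open>a \<ge> n j - n i\<close> cancel
  under \<open>a \<mapsto> n j - n i + m - a\<close>.\<close>

lemma alternating_on_pair_sum:
  assumes alt: "alternating_on S \<Phi>" and ij: "i \<in> S" "j \<in> S" and less: "n i < n j"
    and full: "\<And>u. n i < u \<Longrightarrow> u < n j \<Longrightarrow> \<exists>l\<in>S. n l = u"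
  shows "(\<Sum>a\<le>m. \<Phi> (shift i a (shift j (m - a) n))) = \<Phi> (shift j m n)"
proof -
  let ?g = "\<lambda>a. \<Phi> (shift i a (shift j (m - a) n))"
  define d where "d = n j - n i"
  have d: "d > 0" "n j = n i + d" using less by (auto simp: d_def)
  have ne: "i \<noteq> j" using less by auto
  have mid: "?g a = 0" if a: "0 < a" "a < d" for a
  proof -
    obtain l where l: "l \<in> S" "n l = n i + a" using full[of "n i + a"] a d by auto
    with a d have "l \<noteq> i" "l \<noteq> j" by auto
    then show ?thesis
      by (intro alternating_on_eq_0[OF alt ij(1) l(1)]) (use l ne in \<open>auto simp: shift_apply\<close>)
  qed
  have refl: "?g (d + m - a) = - ?g a" if a: "d \<le> a" "a \<le> m" for a
  proof -
    have "shift i (d + m - a) (shift j (m - (d + m - a)) n)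
        = shift i a (shift j (m - a) n) \<circ> Transposition.transpose i j"
      using a d ne by (auto simp: fun_eq_iff shift_apply Transposition.transpose_def)
    then show ?thesis
      by (simp add: alternating_onD[OF alt ij ne])
  qed
  have "(\<Sum>a\<in>{d..m}. ?g a) = (\<Sum>a\<in>{d..m}. ?g (d + m - a))"
    by (rule sum.reindex_bij_witness[of _ "\<lambda>a. d + m - a" "\<lambda>a. d + m - a"]) auto
  also have "\<dots> = - (\<Sum>a\<in>{d..m}. ?g a)"
    unfolding sum_negf[symmetric] by (rule sum.cong) (use refl in auto)
  finally have hi: "(\<Sum>a\<in>{d..m}. ?g a) = 0" by simp
  have "{..m} = ({..m} \<inter> {..<d}) \<union> {d..m}" by auto
  then have "(\<Sum>a\<le>m. ?g a) = (\<Sum>a\<in>{..m} \<inter> {..<d}. ?g a) + (\<Sum>a\<in>{d..m}. ?g a)"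
    by (subst sum.union_disjoint[symmetric]) auto
  also have "(\<Sum>a\<in>{..m} \<inter> {..<d}. ?g a) = (\<Sum>a\<in>{0}. ?g a)"
    by (rule sum.mono_neutral_right) (use d mid in auto)
  finally show ?thesis using hi by simp
qed

text \<open>Expand over ordered pairs of indices. Diagonal pairs give the factor
  \<open>m + 1\<close>; an unequal pair collapses by \<open>alternating_on_pair_sum\<close> to the
  term raising its larger index by \<open>m\<close>. On a staircase \<open>n i\<close> indices lie
  below \<open>i\<close>, and both orders of a pair occur, whence \<open>2 * n i\<close>.\<close>

lemma psum_psum_staircase:
  fixes m o' k :: nat
  assumes alt: "alternating_on S \<Phi>" and S: "S = {o'..<o' + k}"
    and n: "\<And>t. t < k \<Longrightarrow> n (o' + t) = t"
  shows "(\<Sum>a\<le>m. psum S a (psum S (m - a) \<Phi>) n)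
       = (real m + 1) * psum S m \<Phi> n + 2 * (\<Sum>i\<in>S. real (n i) * \<Phi> (shift i m n))"
proof -
  define F where "F l = \<Phi> (shift l m n)" for l
  have fin: "finite S" using S by auto
  have nS: "n i = i - o'" if "i \<in> S" for i using n[of "i - o'"] that S by auto
  have pair: "(\<Sum>a\<le>m. \<Phi> (shift i a (shift j (m - a) n))) = F j"
    if "i \<in> S" "j \<in> S" "i < j" for i j
    unfolding F_def
  proof (rule alternating_on_pair_sum[OF alt that(1,2)])
    show "n i < n j" using that S by (auto simp: nS)
    show "\<exists>l\<in>S. n l = u" if "n i < u" "u < n j" for u
      using that nS[OF \<open>j \<in> S\<close>] \<open>j \<in> S\<close> S n[of u] by (intro bexI[of _ "o' + u"]) auto
  qed
  have pair': "(\<Sum>a\<le>m. \<Phi> (shift i a (shift j (m - a) n))) = F i"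
    if "i \<in> S" "j \<in> S" "j < i" for i j
  proof -
    have "(\<Sum>a\<le>m. \<Phi> (shift i a (shift j (m - a) n)))
        = (\<Sum>a\<le>m. \<Phi> (shift j a (shift i (m - a) n)))"
      by (rule sum.reindex_bij_witness[of _ "\<lambda>a. m - a" "\<lambda>a. m - a"])
         (auto simp: shift_commute)
    with pair[of j i] that show ?thesis by simp
  qed
  have diag: "(\<Sum>a\<le>m. \<Phi> (shift i a (shift i (m - a) n))) = (real m + 1) * F i" for i
    by (simp add: F_def)
  have inner: "(\<Sum>a\<le>m. \<Phi> (shift j (m - a) (shift i a n)))
     = (if j = i then (real m + 1) * F i else 0) + (if i < j then F j else 0)
       + (if j < i then F i else 0)" if "i \<in> S" "j \<in> S" for i j
    using pair[of i j] pair'[of i j] diag[of i] that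
    by (cases i j rule: linorder_cases) (simp_all add: shift_commute[of j])
  have cnt: "real (card {i\<in>S. i < j}) = real (n j)" if "j \<in> S" for j
  proof -
    have "{i\<in>S. i < j} = {o'..<j}" using that S by auto
    then show ?thesis using nS[OF that] by simp
  qed
  have c1: "(\<Sum>i\<in>S. if i < j then F j else 0) = real (n j) * F j" if "j \<in> S" for j
  proof -
    have "(\<Sum>i\<in>S. if i < j then F j else 0) = (\<Sum>i\<in>{i\<in>S. i < j}. F j)"
      using fin by (rule sum.inter_filter[symmetric])
    then show ?thesis using cnt[OF that] by simp
  qed
  have "(\<Sum>a\<le>m. psum S a (psum S (m - a) \<Phi>) n)
      = (\<Sum>a\<le>m. \<Sum>i\<in>S. \<Sum>j\<in>S. \<Phi> (shift j (m - a) (shift i a n)))"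
    by (simp add: psum_def)
  also have "\<dots> = (\<Sum>i\<in>S. \<Sum>a\<le>m. \<Sum>j\<in>S. \<Phi> (shift j (m - a) (shift i a n)))"
    by (rule sum.swap)
  also have "\<dots> = (\<Sum>i\<in>S. \<Sum>j\<in>S. \<Sum>a\<le>m. \<Phi> (shift j (m - a) (shift i a n)))"
    by (intro sum.cong refl sum.swap)
  also have "\<dots> = (\<Sum>i\<in>S. \<Sum>j\<in>S. (if j = i then (real m + 1) * F i else 0)
        + (if i < j then F j else 0) + (if j < i then F i else 0))"
    by (intro sum.cong refl inner)
  also have "\<dots> = (\<Sum>i\<in>S. (real m + 1) * F i)
       + (\<Sum>j\<in>S. \<Sum>i\<in>S. if i < j then F j else 0)
       + (\<Sum>i\<in>S. \<Sum>j\<in>S. if j < i then F i else 0)"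
    unfolding sum.distrib by (subst (3) sum.swap) (simp add: fin sum.delta)
  also have "\<dots> = (real m + 1) * psum S m \<Phi> n + 2 * (\<Sum>i\<in>S. real (n i) * \<Phi> (shift i m n))"
    by (simp add: c1 sum_distrib_left F_def psum_def)
  finally show ?thesis .
qed

abbreviation staircase :: "nat \<Rightarrow> nat \<Rightarrow> nat" where
  "staircase k \<equiv> (\<lambda>i. if i < k then i else i - k)"

section \<open>Loop equations for an abstract alternant\<close>

text \<open>\<open>trace\<close> and \<open>euler\<close> abstract the traces of multiplication by
  \<open>z^r\<close> and of \<open>z^(m + 1) d/dz\<close> modulo \<open>z^(2k)\<close>. The
  derivation sends \<open>z^n exp (\<epsilon> z)\<close> to
  \<open>(n z^(n + m) + \<epsilon> z^(n + m + 1)) exp (\<epsilon> z)\<close>, and for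
  \<open>m = 0\<close> its trace is the sum of the exponents below \<open>2k\<close>.\<close>

locale alternant =
  fixes k :: nat and \<Phi> :: "(nat \<Rightarrow> nat) \<Rightarrow> real"
  assumes alt1: "alternating_on {..<k} \<Phi>" and alt2: "alternating_on {k..<2*k} \<Phi>"
    and trace: "r \<ge> 1 \<Longrightarrow> psum {..<k} r \<Phi> n + psum {k..<2*k} r \<Phi> n = 0"
    and euler: "(\<Sum>i<2*k. real (n i) * \<Phi> (shift i m n))
                 + psum {..<k} (Suc m) \<Phi> n - psum {k..<2*k} (Suc m) \<Phi> n
               = (if m = 0 then real k * (2 * real k - 1) * \<Phi> n else 0)"
begin

abbreviation "P \<equiv> {..<k}"
abbreviation "Q \<equiv> {k..<2*k}"
abbreviation "\<delta> \<equiv> staircase k"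

lemma psum_Q_pw: "r \<ge> 1 \<Longrightarrow> psum Q r (pw P ls \<Phi>) = (\<lambda>n. - pw P (r # ls) \<Phi> n)"
proof -
  assume r: "r \<ge> 1"
  have "psum Q r \<Phi> = (\<lambda>n. - psum P r \<Phi> n)"
    using trace[OF r] by (auto simp: fun_eq_iff algebra_simps eq_neg_iff_add_eq_0)
  then have "psum Q r (pw P ls \<Phi>) = pw P ls (\<lambda>n. - psum P r \<Phi> n)"
    by (simp add: psum_pw_commute)
  also have "\<dots> = (\<lambda>n. - pw P ls (psum P r \<Phi>) n)"
    by (induction ls) (auto simp: psum_uminus)
  finally show ?thesis by (simp add: psum_pw_commute)
qed

text \<open>The derivation is commuted past the power sums one at a time. Its commutator with the
  \<open>r\<close>-th power sum is \<open>r\<close> times the \<open>(r + m)\<close>-th, so every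
  part contributes one term in which it is raised by \<open>m\<close>.\<close>

lemma euler_pw:
  "(\<Sum>i<2*k. real (n i) * pw P ls \<Phi> (shift i m n))
     + psum P (Suc m) (pw P ls \<Phi>) n - psum Q (Suc m) (pw P ls \<Phi>) n
   = (if m = 0 then real k * (2 * real k - 1) * pw P ls \<Phi> n else 0)
     - (\<Sum>t<length ls. real (ls ! t) * pw P (ls[t := ls ! t + m]) \<Phi> n)"
proof (induction ls arbitrary: n)
  case Nil
  show ?case using euler[of n m] by simp
next
  case (Cons r ls)
  let ?F = "pw P ls \<Phi>"
  have "(\<Sum>i<2*k. real (n i) * psum P r ?F (shift i m n))
      = (\<Sum>j\<in>P. \<Sum>i<2*k. real (n i) * ?F (shift i m (shift j r n)))"
    by (subst sum.swap) (simp add: psum_def sum_distrib_left shift_commute)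
  \<comment> \<open>The induction hypothesis needs weights read off the shifted vector; these exceed
    the present ones by \<open>r\<close> at \<open>i = j\<close> only.\<close>
  also have "\<dots> = (\<Sum>j\<in>P. (\<Sum>i<2*k. real (shift j r n i) * ?F (shift i m (shift j r n)))
                    - real r * ?F (shift j (r + m) n))"
  proof (intro sum.cong refl)
    fix j assume j: "j \<in> P"
    have "(\<Sum>i<2*k. real (shift j r n i) * ?F (shift i m (shift j r n)))
        = (\<Sum>i<2*k. real (n i) * ?F (shift i m (shift j r n))
              + (if i = j then real r * ?F (shift i m (shift j r n)) else 0))"
      by (intro sum.cong refl) (auto simp: shift_apply algebra_simps)
    also have "\<dots> = (\<Sum>i<2*k. real (n i) * ?F (shift i m (shift j r n)))
              + real r * ?F (shift j m (shift j r n))"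
      unfolding sum.distrib using j by (subst sum.delta) auto
    finally show "(\<Sum>i<2*k. real (n i) * ?F (shift i m (shift j r n))) =
        (\<Sum>i<2*k. real (shift j r n i) * ?F (shift i m (shift j r n)))
          - real r * ?F (shift j (r + m) n)"
      by simp
  qed
  also have "\<dots> = (\<Sum>j\<in>P. (if m = 0 then real k * (2 * real k - 1) * ?F (shift j r n) else 0)
      - (\<Sum>t<length ls. real (ls ! t) * pw P (ls[t := ls ! t + m]) \<Phi> (shift j r n))
      - psum P (Suc m) ?F (shift j r n) + psum Q (Suc m) ?F (shift j r n)
      - real r * ?F (shift j (r + m) n))"
  proof (intro sum.cong refl)
    fix j assume "j \<in> P"
    show "(\<Sum>i<2*k. real (shift j r n i) * ?F (shift i m (shift j r n))) - real r * ?F (shift j (r + m) n)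
      = (if m = 0 then real k * (2 * real k - 1) * ?F (shift j r n) else 0)
      - (\<Sum>t<length ls. real (ls ! t) * pw P (ls[t := ls ! t + m]) \<Phi> (shift j r n))
      - psum P (Suc m) ?F (shift j r n) + psum Q (Suc m) ?F (shift j r n)
      - real r * ?F (shift j (r + m) n)"
      using Cons.IH[of "shift j r n"] by linarith
  qed
  also have "\<dots> = (if m = 0 then real k * (2 * real k - 1) * psum P r ?F n else 0)
      - (\<Sum>t<length ls. real (ls ! t) * psum P r (pw P (ls[t := ls ! t + m]) \<Phi>) n)
      - psum P r (psum P (Suc m) ?F) n + psum P r (psum Q (Suc m) ?F) n
      - real r * psum P (r + m) ?F n"
  proof -
    have "(\<Sum>j\<in>P. \<Sum>t<length ls. real (ls ! t) * pw P (ls[t := ls ! t + m]) \<Phi> (shift j r n))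
        = (\<Sum>t<length ls. real (ls ! t) * psum P r (pw P (ls[t := ls ! t + m]) \<Phi>) n)"
      by (subst sum.swap) (simp add: psum_def sum_distrib_left)
    then show ?thesis
      unfolding sum.distrib sum_subtractf by (simp add: psum_def sum_distrib_left)
  qed
  finally have "(\<Sum>i<2*k. real (n i) * psum P r ?F (shift i m n)) = \<dots>" .
  moreover have "(\<Sum>t<length (r # ls). real ((r # ls) ! t) * pw P ((r # ls)[t := (r # ls) ! t + m]) \<Phi> n)
    = real r * psum P (r + m) ?F n
      + (\<Sum>t<length ls. real (ls ! t) * psum P r (pw P (ls[t := ls ! t + m]) \<Phi>) n)"
    by (simp add: lessThan_Suc_eq_insert_0 sum.reindex)
  ultimately show ?case
    by (simp add: psum_commute)
qed

text \<open>Add the staircase identity over both halves. For \<open>m > 0\<close> the terms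
  \<open>a = 0\<close>, \<open>a = m\<close> and the diagonal ones cancel, since positive power sums
  on the halves are opposite; for \<open>0 < a < m\<close> two sign changes make the halves agree.
  For \<open>m = 0\<close> there remains \<open>2k^2 - 2k\<close>.\<close>

lemma euler_at_\<delta>:
  "2 * (\<Sum>i<2*k. real (\<delta> i) * pw P ls \<Phi> (shift i m \<delta>))
   = (if m = 0 then 2 * real k * (real k - 1) * pw P ls \<Phi> \<delta>
      else 2 * (\<Sum>a\<in>{1..<m}. pw P (a # (m - a) # ls) \<Phi> \<delta>))"
proof -
  let ?F = "pw P ls \<Phi>"
  have altP: "alternating_on P ?F" and altQ: "alternating_on Q ?F"
    by (auto intro!: alternating_on_pw alt1 alt2)
  have "(\<Sum>a\<le>m. psum P a (psum P (m - a) ?F) \<delta>)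
       = (real m + 1) * psum P m ?F \<delta> + 2 * (\<Sum>i\<in>P. real (\<delta> i) * ?F (shift i m \<delta>))"
    by (rule psum_psum_staircase[of _ _ 0 k]) (use altP in auto)
  moreover have "(\<Sum>a\<le>m. psum Q a (psum Q (m - a) ?F) \<delta>)
       = (real m + 1) * psum Q m ?F \<delta> + 2 * (\<Sum>i\<in>Q. real (\<delta> i) * ?F (shift i m \<delta>))"
    by (rule psum_psum_staircase[of _ _ k k]) (use altQ in auto)
  moreover have "(\<Sum>i<2*k. real (\<delta> i) * ?F (shift i m \<delta>))
      = (\<Sum>i\<in>P. real (\<delta> i) * ?F (shift i m \<delta>)) + (\<Sum>i\<in>Q. real (\<delta> i) * ?F (shift i m \<delta>))"
    by (subst sum.union_disjoint[symmetric]) (auto intro!: sum.cong)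
  ultimately have *: "2 * (\<Sum>i<2*k. real (\<delta> i) * ?F (shift i m \<delta>))
     = (\<Sum>a\<le>m. psum P a (psum P (m - a) ?F) \<delta> + psum Q a (psum Q (m - a) ?F) \<delta>)
       - (real m + 1) * (psum P m ?F \<delta> + psum Q m ?F \<delta>)"
    by (simp add: sum.distrib algebra_simps)
  show ?thesis
  proof (cases "m = 0")
    case True
    then show ?thesis using * by (simp add: psum_0 algebra_simps)
  next
    case False
    have cancel: "psum P m ?F \<delta> + psum Q m ?F \<delta> = 0"
      using False by (simp add: psum_Q_pw)
    have cancel0: "psum P 0 (psum P m ?F) \<delta> + psum Q 0 (psum Q m ?F) \<delta> = 0"
    proof -
      have "psum P 0 (psum P m ?F) \<delta> + psum Q 0 (psum Q m ?F) \<delta>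
          = real k * (psum P m ?F \<delta> + psum Q m ?F \<delta>)"
        unfolding psum_0 by (simp add: distrib_left)
      with cancel show ?thesis by simp
    qed
    have split: "{..m} = insert 0 (insert m {1..<m})" using False by auto
    have "(\<Sum>a\<le>m. psum P a (psum P (m - a) ?F) \<delta> + psum Q a (psum Q (m - a) ?F) \<delta>)
        = (\<Sum>a\<in>{1..<m}. psum P a (psum P (m - a) ?F) \<delta> + psum Q a (psum Q (m - a) ?F) \<delta>)"
      unfolding split using False cancel0
      by (simp add: psum_commute[of P m P 0] psum_commute[of Q m Q 0])
    also have "\<dots> = (\<Sum>a\<in>{1..<m}. 2 * pw P (a # (m - a) # ls) \<Phi> \<delta>)"
    proof (intro sum.cong refl)
      fix a assume a: "a \<in> {1..<m}"
      have "m - a \<ge> 1" using a by auto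
      then have "psum Q a (psum Q (m - a) ?F) = psum Q a (\<lambda>n. - pw P ((m - a) # ls) \<Phi> n)"
        by (simp only: psum_Q_pw)
      also have "\<dots> = pw P (a # (m - a) # ls) \<Phi>"
        using a psum_Q_pw[of a "(m - a) # ls"] by (simp add: psum_uminus)
      finally show "psum P a (psum P (m - a) ?F) \<delta> + psum Q a (psum Q (m - a) ?F) \<delta>
          = 2 * pw P (a # (m - a) # ls) \<Phi> \<delta>" by simp
    qed
    finally show ?thesis using * cancel False by (simp add: sum_distrib_left)
  qed
qed

text \<open>Compare the two evaluations of the Euler sum at \<open>m = 0\<close>:
  \<open>k (2k - 1) - k (k - 1) = k^2\<close>, and the raised parts contribute the weight of
  \<open>ls\<close>.\<close>

lemma pw_Cons_1: "pw P (Suc 0 # ls) \<Phi> \<delta> = ((real k)\<^sup>2 - real (sum_list ls)) / 2 * pw P ls \<Phi> \<delta>"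
proof -
  have "(\<Sum>t<length ls. real (ls ! t) * pw P (ls[t := ls ! t]) \<Phi> \<delta>)
      = real (sum_list ls) * pw P ls \<Phi> \<delta>"
    by (simp add: sum_list_sum_nth sum_distrib_right atLeast0LessThan)
  then show ?thesis
    using euler_pw[where n = \<delta> and m = 0 and ls = ls] euler_at_\<delta>[where m = 0 and ls = ls]
      psum_Q_pw[of "Suc 0" ls]
    by (simp add: algebra_simps power2_eq_square)
qed

text \<open>The same comparison for \<open>m > 0\<close>. Every list on the right has weight one
  less than the list on the left, so this serves as a recursion.\<close>

lemma pw_Cons_Suc:
  assumes "m \<ge> 1"
  shows "pw P (Suc m # ls) \<Phi> \<delta> = - 1 / 2 * ((\<Sum>a\<in>{1..<m}. pw P (a # (m - a) # ls) \<Phi> \<delta>)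
           + (\<Sum>t<length ls. real (ls ! t) * pw P (ls[t := ls ! t + m]) \<Phi> \<delta>))"
  using euler_pw[where n = \<delta> and m = m and ls = ls] euler_at_\<delta>[where m = m and ls = ls]
    psum_Q_pw[of "Suc m" ls] assms
  by (simp add: algebra_simps)

end

section \<open>Sums over rearrangements\<close>

fun shifts :: "nat list \<Rightarrow> nat list \<Rightarrow> (nat \<Rightarrow> nat) \<Rightarrow> nat \<Rightarrow> nat" where
  "shifts (i # is) (r # rs) n = shift i r (shifts is rs n)"
| "shifts _ _ n = n"

lemma shifts_apply: "shifts is rs n j = n j + shifts is rs (\<lambda>_. 0) j"
  by (induction "is" rs n rule: shifts.induct) (auto simp: shift_apply)

lemma shifts_list_update:
  assumes "t < length is" "length is = length rs"
  shows "shifts is (rs[t := rs ! t + r]) n = shift (is ! t) r (shifts is rs n)"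
  using assms
proof (induction "is" rs n arbitrary: t rule: shifts.induct)
  case (1 i "is" s rs n)
  then show ?case by (cases t) (auto simp: shift_commute[of i])
qed auto

text \<open>Positive parts make the chosen indices visible in the exponents; this later confines
  index lists to a finite range.\<close>

lemma shifts_pos_iff:
  assumes "length is = length rs" "0 \<notin> set rs"
  shows "shifts is rs (\<lambda>_. 0) j > 0 \<longleftrightarrow> j \<in> set is"
  using assms
proof (induction "is" rs "\<lambda>_::nat. 0::nat" rule: shifts.induct)
  case (1 i "is" s rs)
  then show ?case by (auto simp: shift_apply)
qed auto

lemma shifts_map:
  assumes "inj f"
  shows "shifts (map f is) rs (\<lambda>_. 0) (f j) = shifts is rs (\<lambda>_. 0) j"
  using assms
  by (induction "is" rs "\<lambda>_::nat. 0::nat" rule: shifts.induct) (auto simp: shift_apply inj_eq)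

lemma image_mset_shifts:
  assumes "finite S" "distinct is" "set is \<subseteq> S" "length is = length rs"
  shows "image_mset (shifts is rs (\<lambda>_. 0)) (mset_set S) = mset rs + replicate_mset (card S - length rs) 0"
  using assms
proof (induction "is" rs "\<lambda>_::nat. 0::nat" rule: shifts.induct)
  case (1 i "is" s rs)
  let ?f = "shifts is rs (\<lambda>_. 0)" and ?T = "mset_set (S - {i})"
  have i: "i \<in> S" "i \<notin> set is" and IH: "image_mset ?f (mset_set S) = mset rs + replicate_mset (card S - length rs) 0"
    using 1 by auto
  have S: "mset_set S = add_mset i ?T"
    using i 1(2) by (metis mset_set.remove)
  have "length rs < card S"
  proof -
    have "card (set (i # is)) \<le> card S" using 1 by (intro card_mono) auto
    then show ?thesis using 1 by (simp add: distinct_card)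
  qed
  then have c: "card S - length rs = Suc (card S - Suc (length rs))" by auto
  have fi: "shifts js ts (\<lambda>_. 0) i = 0" if "i \<notin> set js" for js ts
    using that by (induction js ts "\<lambda>_::nat. 0::nat" rule: shifts.induct) (auto simp: shift_apply)
  have "add_mset 0 (image_mset ?f ?T) = add_mset 0 (mset rs + replicate_mset (card S - Suc (length rs)) 0)"
    using IH fi[OF i(2)] by (simp add: S c)
  then have "image_mset ?f ?T = mset rs + replicate_mset (card S - Suc (length rs)) 0" by simp
  moreover have "image_mset (shift i s ?f) ?T = image_mset ?f ?T"
    using 1(2) by (intro image_mset_cong) (auto simp: shift_apply)
  ultimately show ?case
    using fi[OF i(2)] by (simp add: S shift_apply)
qed (auto simp: image_mset_const_eq)

definition inj_lists :: "nat set \<Rightarrow> nat \<Rightarrow> nat list set" where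
  "inj_lists S m = {is. length is = m \<and> distinct is \<and> set is \<subseteq> S}"

lemma finite_inj_lists: "finite S \<Longrightarrow> finite (inj_lists S m)"
  unfolding inj_lists_def
  by (rule finite_subset[OF _ finite_lists_length_eq[of S m]]) auto

text \<open>The operator \<open>inj_sum S rs\<close> plays the role of multiplication by the augmented monomial
  symmetric function of \<open>rs\<close> in the variables indexed by \<open>S\<close>, just as \<open>psum S r\<close> is
  multiplication by the \<open>r\<close>-th power sum.\<close>

definition inj_sum :: "nat set \<Rightarrow> nat list \<Rightarrow> ((nat \<Rightarrow> nat) \<Rightarrow> real) \<Rightarrow> (nat \<Rightarrow> nat) \<Rightarrow> real" where
  "inj_sum S rs \<Phi> n = (\<Sum>is\<in>inj_lists S (length rs). \<Phi> (shifts is rs n))"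

lemma inj_sum_Nil [simp]: "inj_sum S [] \<Phi> = \<Phi>"
proof -
  have "inj_lists S 0 = {[]}" by (auto simp: inj_lists_def)
  then show ?thesis by (auto simp: inj_sum_def fun_eq_iff)
qed

lemma inj_sum_uminus: "inj_sum S rs (\<lambda>n. - \<Phi> n) = (\<lambda>n. - inj_sum S rs \<Phi> n)"
  by (auto simp: inj_sum_def sum_negf)

lemma inj_sum_diff: "inj_sum S rs (\<lambda>n. \<Phi> n - \<Psi> n) = (\<lambda>n. inj_sum S rs \<Phi> n - inj_sum S rs \<Psi> n)"
  by (auto simp: inj_sum_def sum_subtractf)

lemma inj_sum_sum: "inj_sum S rs (\<lambda>n. \<Sum>t\<in>T. \<Phi> t n) = (\<lambda>n. \<Sum>t\<in>T. inj_sum S rs (\<Phi> t) n)"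
  unfolding inj_sum_def by (rule ext) (rule sum.swap)

text \<open>Letting the new index run over all of \<open>S\<close> gives the power sum; each
  coincidence with an index already chosen merges \<open>r\<close> into the part placed
  there.\<close>

lemma inj_sum_Cons:
  assumes fin: "finite S"
  shows "inj_sum S (r # rs) \<Phi> n
       = inj_sum S rs (psum S r \<Phi>) n - (\<Sum>t<length rs. inj_sum S (rs[t := rs ! t + r]) \<Phi> n)"
proof -
  let ?I = "inj_lists S (length rs)"
  have finI: "finite ?I" using fin by (rule finite_inj_lists)
  have "inj_sum S (r # rs) \<Phi> n = (\<Sum>js\<in>(\<lambda>(is, i). i # is) ` (SIGMA is:?I. S - set is). \<Phi> (shifts js (r # rs) n))"
    unfolding inj_sum_def
    by (intro sum.cong refl) (auto simp: inj_lists_def image_iff length_Suc_conv)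
  also have "\<dots> = (\<Sum>(is, i)\<in>(SIGMA is:?I. S - set is). \<Phi> (shift i r (shifts is rs n)))"
    by (subst sum.reindex) (auto simp: inj_on_def intro!: sum.cong)
  also have "\<dots> = (\<Sum>is\<in>?I. \<Sum>i\<in>S - set is. \<Phi> (shift i r (shifts is rs n)))"
    using finI fin by (subst sum.Sigma) auto
  also have "\<dots> = (\<Sum>is\<in>?I. psum S r \<Phi> (shifts is rs n)
                    - (\<Sum>t<length rs. \<Phi> (shifts is (rs[t := rs ! t + r]) n)))"
  proof (intro sum.cong refl)
    fix "is" assume "is": "is \<in> ?I"
    have "(\<Sum>i\<in>S - set is. \<Phi> (shift i r (shifts is rs n)))
        = psum S r \<Phi> (shifts is rs n) - (\<Sum>i\<in>set is. \<Phi> (shift i r (shifts is rs n)))"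
      using "is" fin by (subst sum_diff) (auto simp: inj_lists_def psum_def)
    also have "(\<Sum>i\<in>set is. \<Phi> (shift i r (shifts is rs n)))
        = (\<Sum>t<length rs. \<Phi> (shift (is ! t) r (shifts is rs n)))"
      using "is" by (intro sum.reindex_bij_betw[symmetric] bij_betw_nth) (auto simp: inj_lists_def)
    also have "\<dots> = (\<Sum>t<length rs. \<Phi> (shifts is (rs[t := rs ! t + r]) n))"
      using "is" by (intro sum.cong refl) (auto simp: inj_lists_def shifts_list_update)
    finally show "(\<Sum>i\<in>S - set is. \<Phi> (shift i r (shifts is rs n)))
      = psum S r \<Phi> (shifts is rs n) - (\<Sum>t<length rs. \<Phi> (shifts is (rs[t := rs ! t + r]) n))" .
  qed
  also have "\<dots> = inj_sum S rs (psum S r \<Phi>) n - (\<Sum>t<length rs. inj_sum S (rs[t := rs ! t + r]) \<Phi> n)"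
    unfolding sum_subtractf inj_sum_def by (simp add: sum.swap[of _ ?I])
  finally show ?thesis .
qed

section \<open>Rearrangements and their multiplicities\<close>

definition zero_extend :: "nat list \<Rightarrow> nat \<Rightarrow> nat" where
  "zero_extend s j = (if j < length s then s ! j else 0)"

lemma zero_extend_pad [simp]: "zero_extend (pad k rs) = zero_extend rs"
  by (auto simp: zero_extend_def pad_def nth_append fun_eq_iff)

text \<open>The ways to produce one given exponent function. Indices range over all naturals, so the
  count does not involve \<open>k\<close>.\<close>

definition placements :: "nat list \<Rightarrow> (nat \<Rightarrow> nat) \<Rightarrow> nat list set" where
  "placements rs f = {is. length is = length rs \<and> distinct is \<and> shifts is rs (\<lambda>_. 0) = f}"

text \<open>Relabelling the indices by the inverse of \<open>p\<close> is a bijection between the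
  two sets of placements.\<close>

lemma card_placements_permute:
  assumes "bij p" "g = f \<circ> p"
  shows "card (placements rs f) = card (placements rs g)"
proof -
  define q where "q = inv_into UNIV p"
  have inj: "inj p" "inj q" and pp: "p (q j) = j" "q (p j) = j" for j
    using assms(1) by (auto simp: bij_is_inj bij_is_surj surj_f_inv_f q_def bij_imp_bij_inv)
  have "bij_betw (map q) (placements rs f) (placements rs g)"
  proof (rule bij_betw_byWitness[where f' = "map p"])
    show "map q ` placements rs f \<subseteq> placements rs g"
    proof (clarsimp simp: placements_def assms(2) distinct_map inj_on_subset[OF inj(2)] fun_eq_iff)
      fix "is" j assume "\<forall>x. shifts is rs (\<lambda>_. 0) x = f x"
      then show "shifts (map q is) rs (\<lambda>_. 0) j = f (p j)"
        using shifts_map[OF inj(2), of "is" rs "p j"] by (simp add: pp)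
    qed
    show "map p ` placements rs g \<subseteq> placements rs f"
    proof (clarsimp simp: placements_def assms(2) distinct_map inj_on_subset[OF inj(1)] fun_eq_iff)
      fix "is" j assume "\<forall>x. shifts is rs (\<lambda>_. 0) x = f (p x)"
      then show "shifts (map p is) rs (\<lambda>_. 0) j = f j"
        using shifts_map[OF inj(1), of "is" rs "q j"] by (simp add: pp)
    qed
  qed (auto simp: pp comp_def)
  then show ?thesis by (rule bij_betw_same_card)
qed

lemma shifts_upt: "shifts [0..<length rs] rs (\<lambda>_. 0) = zero_extend rs"
proof -
  have gen: "shifts [a..<a + length rs] rs (\<lambda>_. 0) j
      = (if a \<le> j \<and> j < a + length rs then rs ! (j - a) else 0)" for a j
  proof (induction rs arbitrary: a)
    case (Cons r rs)
    have "[a..<a + length (r # rs)] = a # [Suc a..<Suc a + length rs]"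
      by (simp add: upt_rec)
    then show ?case using Cons[of "Suc a"] 
      by (auto simp: shift_apply nth_Cons' simp del: upt_Suc)
  qed auto
  show ?thesis using gen[of 0] by (auto simp: zero_extend_def fun_eq_iff)
qed

text \<open>Positivity of the parts keeps the indices below \<open>length rs\<close>, which gives
  finiteness; placing the parts in order shows that a placement exists.\<close>

lemma card_placements_pos:
  assumes "0 \<notin> set rs"
  shows "card (placements rs (zero_extend rs)) > 0"
proof -
  have "placements rs (zero_extend rs) \<subseteq> inj_lists {..<length rs} (length rs)"
  proof
    fix "is" assume "is": "is \<in> placements rs (zero_extend rs)"
    have "j < length rs" if "j \<in> set is" for j
    proof -
      have "zero_extend rs j > 0"
        using that "is" shifts_pos_iff[of "is" rs j] assms by (auto simp: placements_def)
      then show ?thesis by (auto simp: zero_extend_def split: if_splits)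
    qed
    with "is" show "is \<in> inj_lists {..<length rs} (length rs)"
      by (auto simp: placements_def inj_lists_def)
  qed
  then have "finite (placements rs (zero_extend rs))"
    by (rule finite_subset) (simp add: finite_inj_lists)
  moreover have "[0..<length rs] \<in> placements rs (zero_extend rs)"
    by (auto simp: placements_def shifts_upt)
  ultimately show ?thesis by (auto simp: card_gt_0_iff)
qed

lemma card_placements_permutation:
  assumes s: "mset s = mset (pad k rs)"
  shows "card (placements rs (zero_extend s)) = card (placements rs (zero_extend rs))"
proof -
  from s obtain p where p: "p permutes {..<length (pad k rs)}" "permute_list p (pad k rs) = s"
    by (rule mset_eq_permutation)
  have len: "length s = length (pad k rs)" using s by (rule mset_eq_length)
  have "zero_extend s = zero_extend (pad k rs) \<circ> p"
  proof
    fix j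
    show "zero_extend s j = (zero_extend (pad k rs) \<circ> p) j"
    proof (cases "j < length s")
      case True
      then have "p j < length (pad k rs)" using permutes_in_image[OF p(1), of j] len by auto
      with True show ?thesis using permute_list_nth[OF p(1), of j] p(2) len
        by (simp add: zero_extend_def del: zero_extend_pad)
    next
      case False
      then have "p j = j" using permutes_not_in[OF p(1)] len by auto
      with False len show ?thesis by (simp add: zero_extend_def del: zero_extend_pad)
    qed
  qed
  from card_placements_permute[OF permutes_bij[OF p(1)] this, of rs] show ?thesis by simp
qed

definition add_at :: "nat \<Rightarrow> (nat \<Rightarrow> nat) \<Rightarrow> (nat \<Rightarrow> nat) \<Rightarrow> nat \<Rightarrow> nat" where
  "add_at b f n j = (if b \<le> j then n j + f (j - b) else n j)"

text \<open>Group the index lists by the tuple they produce. The fibres over the distinct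
  rearrangements all have the same size, which does not depend on \<open>k\<close>. The offset
  \<open>b\<close> selects the half of the indices.\<close>

lemma inj_sum_eq_sum_permutations:
  assumes pos: "0 \<notin> set rs" and le: "length rs \<le> k"
  shows "inj_sum {b..<b + k} rs \<Phi> n
       = real (card (placements rs (zero_extend rs)))
         * (\<Sum>s\<in>permutations_of_multiset (mset (pad k rs)). \<Phi> (add_at b (zero_extend s) n))"
proof -
  let ?I = "inj_lists {..<k} (length rs)" and ?A = "permutations_of_multiset (mset (pad k rs))"
  let ?z = "\<lambda>is. shifts is rs (\<lambda>_. 0)"
  let ?g = "\<lambda>is. map (?z is) [0..<k]"
  have ze: "zero_extend (?g is) = ?z is" if "is \<in> ?I" for "is"
  proof
    fix j
    show "zero_extend (?g is) j = ?z is j"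
      using shifts_pos_iff[of "is" rs j] that pos
      by (cases "j < k") (auto simp: zero_extend_def inj_lists_def)
  qed
  have gA: "?g is \<in> ?A" if "is \<in> ?I" for "is"
  proof -
    have "mset (?g is) = image_mset (?z is) (mset_set {..<k})"
      by (simp add: atLeast0LessThan[symmetric] mset_set_upto_eq_mset_upto)
    also have "\<dots> = mset (pad k rs)"
      using that by (subst image_mset_shifts) (auto simp: inj_lists_def pad_def)
    finally show ?thesis by (simp add: permutations_of_multiset_def)
  qed
  have shifts_b: "shifts (map ((+) b) is) rs n = add_at b (?z is) n" for "is"
  proof
    fix j
    have "shifts (map ((+) b) is) rs (\<lambda>_. 0) j = (if b \<le> j then ?z is (j - b) else 0)"
    proof (cases "b \<le> j")
      case True
      then show ?thesis using shifts_map[of "(+) b" "is" rs "j - b"] by simp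
    next
      case False
      then show ?thesis
        by (induction "is" rs "\<lambda>_::nat. 0::nat" rule: shifts.induct) (auto simp: shift_apply)
    qed
    then show "shifts (map ((+) b) is) rs n j = add_at b (?z is) n j"
      by (subst shifts_apply) (auto simp: add_at_def)
  qed
  have fibre: "{is\<in>?I. ?g is = s} = placements rs (zero_extend s)" if s: "s \<in> ?A" for s
  proof -
    have len: "length s = k"
      using that mset_eq_length[of s "pad k rs"] le by (auto simp: permutations_of_multiset_def pad_def)
    show ?thesis
    proof (intro equalityI subsetI)
      fix "is" assume "is \<in> {is\<in>?I. ?g is = s}"
      then show "is \<in> placements rs (zero_extend s)"
        using ze[of "is"] by (auto simp: placements_def inj_lists_def)
    next
      fix "is" assume a: "is \<in> placements rs (zero_extend s)"
      have "j < k" if "j \<in> set is" for j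
      proof -
        have "zero_extend s j > 0"
          using that a shifts_pos_iff[of "is" rs j] pos by (auto simp: placements_def)
        then show ?thesis using len by (auto simp: zero_extend_def split: if_splits)
      qed
      moreover have "?g is = s"
        using a len by (auto simp: placements_def zero_extend_def intro!: nth_equalityI)
      ultimately show "is \<in> {is\<in>?I. ?g is = s}"
        using a by (auto simp: placements_def inj_lists_def)
    qed
  qed
  have "inj_lists {b..<b + k} (length rs) = map ((+) b) ` ?I"
  proof (intro equalityI subsetI)
    fix "is" assume a: "is \<in> inj_lists {b..<b + k} (length rs)"
    then have "is = map ((+) b) (map (\<lambda>j. j - b) is)"
      by (auto simp: inj_lists_def map_idI subset_iff)
    moreover have "map (\<lambda>j. j - b) is \<in> ?I"
      using a by (auto simp: inj_lists_def distinct_map subset_iff less_diff_conv2 intro!: inj_on_diff_nat)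
    ultimately show "is \<in> map ((+) b) ` ?I" by blast
  qed (auto simp: inj_lists_def distinct_map subset_iff)
  then have "inj_sum {b..<b + k} rs \<Phi> n = (\<Sum>is\<in>?I. \<Phi> (shifts (map ((+) b) is) rs n))"
    unfolding inj_sum_def by (simp add: sum.reindex inj_on_def)
  also have "\<dots> = (\<Sum>is\<in>?I. \<Phi> (add_at b (zero_extend (?g is)) n))"
    by (intro sum.cong refl) (simp only: shifts_b ze)
  also have "\<dots> = (\<Sum>s\<in>?A. \<Sum>is\<in>{is\<in>?I. ?g is = s}. \<Phi> (add_at b (zero_extend (?g is)) n))"
    by (rule sum.group[symmetric]) (use gA in \<open>auto simp: finite_inj_lists\<close>)
  also have "\<dots> = (\<Sum>s\<in>?A. real (card {is\<in>?I. ?g is = s}) * \<Phi> (add_at b (zero_extend s) n))"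
    by (intro sum.cong refl) auto
  also have "\<dots> = (\<Sum>s\<in>?A. real (card (placements rs (zero_extend rs))) * \<Phi> (add_at b (zero_extend s) n))"
    by (intro sum.cong refl, subst fibre)
       (auto simp: permutations_of_multiset_def card_placements_permutation[of _ k])
  finally show ?thesis by (simp add: sum_distrib_left)
qed

section \<open>The determinant of truncated exponentials\<close>

text \<open>Laplace expansion along row \<open>i\<close>, whose cofactors do not see that
  row.\<close>

lemma det_mat_row:
  fixes A :: "nat \<Rightarrow> nat \<Rightarrow> real"
  assumes "i < d"
  shows "Determinant.det (mat d d (\<lambda>(l, j). if l = i then v j else A l j))
       = (\<Sum>j<d. v j * cofactor (mat d d (\<lambda>(l, j). A l j)) i j)"
proof -
  let ?M = "mat d d (\<lambda>(l, j). if l = i then v j else A l j)"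
  let ?A = "mat d d (\<lambda>(l, j). A l j)"
  have "cofactor ?M i j = cofactor ?A i j" if "j < d" for j
  proof -
    have "mat_delete ?M i j = mat_delete ?A i j"
      by (rule eq_matI) (auto simp: mat_delete_def)
    then show ?thesis by (simp add: cofactor_def)
  qed
  then show ?thesis
    using assms by (subst laplace_expansion_row[of _ d i]) auto
qed

text \<open>The derivation of the top exterior power induced by \<open>B\<close> is multiplication by the
  trace of \<open>B\<close>.\<close>

lemma sum_det_row_mult_eq_trace:
  fixes A B :: "nat \<Rightarrow> nat \<Rightarrow> real"
  shows "(\<Sum>i<d. Determinant.det (mat d d (\<lambda>(l, j). if l = i then \<Sum>t<d. A i t * B t j else A l j)))
       = (\<Sum>t<d. B t t) * Determinant.det (mat d d (\<lambda>(l, j). A l j))"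
proof -
  let ?A = "mat d d (\<lambda>(l, j). A l j)"
  let ?c = "cofactor ?A"
  have adj: "(\<Sum>i<d. A i t * ?c i j) = (if t = j then Determinant.det ?A else 0)"
    if "t < d" "j < d" for t j
  proof -
    have "(adj_mat ?A * ?A) $$ (j, t) = (\<Sum>i<d. A i t * ?c i j)"
      using that by (auto simp: adj_mat_def scalar_prod_def atLeast0LessThan mult.commute)
    moreover have "adj_mat ?A * ?A = Determinant.det ?A \<cdot>\<^sub>m 1\<^sub>m d"
      by (rule adj_mat) simp
    ultimately show ?thesis using that by auto
  qed
  have "(\<Sum>i<d. Determinant.det (mat d d (\<lambda>(l, j). if l = i then \<Sum>t<d. A i t * B t j else A l j)))
      = (\<Sum>i<d. \<Sum>j<d. \<Sum>t<d. B t j * (A i t * ?c i j))"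
    by (intro sum.cong refl, subst det_mat_row) (auto simp: sum_distrib_right sum_distrib_left mult_ac)
  also have "\<dots> = (\<Sum>j<d. \<Sum>i<d. \<Sum>t<d. B t j * (A i t * ?c i j))"
    by (rule sum.swap)
  also have "\<dots> = (\<Sum>j<d. \<Sum>t<d. \<Sum>i<d. B t j * (A i t * ?c i j))"
    by (intro sum.cong refl sum.swap)
  also have "\<dots> = (\<Sum>j<d. \<Sum>t<d. if t = j then B t j * Determinant.det ?A else 0)"
    by (intro sum.cong refl) (simp add: sum_distrib_left[symmetric] adj)
  finally show ?thesis by (simp add: sum_distrib_right)
qed

text \<open>\<open>exp_coeff \<epsilon> c n\<close> is the coefficient of \<open>z\<^sup>c\<close> in \<open>z\<^sup>n exp (\<epsilon> z)\<close>.\<close>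

definition exp_coeff :: "real \<Rightarrow> nat \<Rightarrow> nat \<Rightarrow> real" where
  "exp_coeff \<epsilon> c n = (if n \<le> c then \<epsilon> ^ (c - n) / fact (c - n) else 0)"

lemma exp_coeff_add: "exp_coeff \<epsilon> c (n + r) = (if r \<le> c then exp_coeff \<epsilon> (c - r) n else 0)"
  by (auto simp: exp_coeff_def add.commute)

text \<open>Both sides are the coefficient of \<open>z^c\<close> in \<open>z^(m + 1) d/dz\<close>
  applied to \<open>z^n exp (\<epsilon> z)\<close>: by the product rule on the left, termwise on the
  right.\<close>

lemma exp_coeff_deriv:
  assumes "c \<ge> m" and "\<epsilon> * \<epsilon> = 1"
  shows "real n * exp_coeff \<epsilon> c (n + m) + \<epsilon> * exp_coeff \<epsilon> c (n + Suc m)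
       = real (c - m) * exp_coeff \<epsilon> (c - m) n"
proof (cases "n + m < c")
  case True
  then obtain e where e: "c = n + m + Suc e" by (metis add_Suc_right less_iff_Suc_add)
  show ?thesis
    by (simp add: e exp_coeff_def field_simps del: of_nat_Suc fact_Suc)
       (simp add: field_simps)
qed (use assms(1) in \<open>auto simp: exp_coeff_def\<close>)

text \<open>Multiplication of \<open>z^n exp (\<epsilon> z)\<close> by
  \<open>exp (\<eta> z)\<close>, where \<open>exp_coeff \<eta> c t\<close> is the contribution of
  \<open>z^t\<close> to \<open>z^c\<close>; the binomial theorem adds the exponents.\<close>

lemma sum_exp_coeff_mult:
  assumes "c < d"
  shows "(\<Sum>t<d. exp_coeff \<epsilon> t n * exp_coeff \<eta> c t) = exp_coeff (\<epsilon> + \<eta>) c n"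
proof (cases "n \<le> c")
  case True
  have "(\<Sum>t<d. exp_coeff \<epsilon> t n * exp_coeff \<eta> c t) = (\<Sum>t\<in>{n..c}. exp_coeff \<epsilon> t n * exp_coeff \<eta> c t)"
    by (rule sum.mono_neutral_right) (use assms in \<open>auto simp: exp_coeff_def\<close>)
  also have "\<dots> = (\<Sum>s\<le>c - n. \<epsilon> ^ s / fact s * (\<eta> ^ (c - n - s) / fact (c - n - s)))"
    by (rule sum.reindex_bij_witness[of _ "\<lambda>s. s + n" "\<lambda>t. t - n"])
       (use True in \<open>auto simp: exp_coeff_def\<close>)
  also have "\<dots> = (\<Sum>s\<le>c - n. real ((c - n) choose s) * \<epsilon> ^ s * \<eta> ^ (c - n - s)) / fact (c - n)"
    unfolding sum_divide_distrib by (intro sum.cong refl) (auto simp: binomial_fact)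
  also have "\<dots> = exp_coeff (\<epsilon> + \<eta>) c n"
    using True by (simp add: binomial_ring exp_coeff_def)
  finally show ?thesis .
next
  case False
  then show ?thesis by (auto simp: exp_coeff_def intro!: sum.neutral)
qed

definition half_sign :: "nat \<Rightarrow> nat \<Rightarrow> real" where
  "half_sign k i = (if i < k then 1 else - 1)"

text \<open>Row \<open>i\<close> of the determinant lists the coefficients of \<open>z\<close> to the power \<open>n i\<close> times
  \<open>exp (\<plusminus>z)\<close> modulo \<open>z\<close> to the power \<open>2k\<close>; column \<open>j\<close> carries the coefficient of index
  \<open>2k - 1 - j\<close>.\<close>

definition exp_det :: "nat \<Rightarrow> (nat \<Rightarrow> nat) \<Rightarrow> real" where
  "exp_det k n = Determinant.det
     (mat (2*k) (2*k) (\<lambda>(i, j). exp_coeff (half_sign k i) (2*k - 1 - j) (n i)))"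

lemma exp_det_shift:
  "exp_det k (shift i r n) = Determinant.det (mat (2*k) (2*k) (\<lambda>(l, j).
     if l = i then exp_coeff (half_sign k i) (2*k - 1 - j) (n i + r)
     else exp_coeff (half_sign k l) (2*k - 1 - j) (n l)))"
  unfolding exp_det_def by (rule arg_cong[of _ _ Determinant.det]) (auto simp: shift_apply)

text \<open>Rows within one half carry the same exponential, so swapping two exponents there swaps
  two rows.\<close>

lemma alternating_on_exp_det:
  assumes "S \<subseteq> {..<k} \<or> S \<subseteq> {k..<2*k}"
  shows "alternating_on S (exp_det k)"
  unfolding alternating_on_def
proof (intro ballI impI allI)
  fix i j n assume ij: "i \<in> S" "j \<in> S" "i \<noteq> j"
  let ?p = "Transposition.transpose i j"
  let ?A = "mat (2*k) (2*k) (\<lambda>(i, j). exp_coeff (half_sign k i) (2*k - 1 - j) (n i))"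
  have p: "?p permutes {0..<2*k}"
    using assms ij by (intro permutes_swap_id) auto
  have lt: "?p l < 2*k" if "l < 2*k" for l
    using permutes_in_image[OF p, of l] that by auto
  have hs: "half_sign k (?p l) = half_sign k l" for l
    using assms ij by (auto simp: half_sign_def Transposition.transpose_def)
  have "exp_det k (n \<circ> ?p) = Determinant.det (mat (2*k) (2*k) (\<lambda>(l, j). ?A $$ (?p l, j)))"
    unfolding exp_det_def by (rule arg_cong[of _ _ Determinant.det]) (rule eq_matI, auto simp: hs lt)
  also have "\<dots> = signof ?p * Determinant.det ?A"
    by (rule det_permute_rows[OF _ p]) simp
  also have "\<dots> = - exp_det k n"
    using ij by (simp add: sign_swap_id exp_det_def)
  finally show "exp_det k (n \<circ> ?p) = - exp_det k n" .
qed

section \<open>Trace identities for the exponential determinant\<close>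

lemma sum_shift_exp_det:
  assumes "r \<ge> 1"
  shows "(\<Sum>i<2*k. exp_det k (shift i r n)) = 0"
proof -
  let ?A = "\<lambda>i j. exp_coeff (half_sign k i) (2*k - 1 - j) (n i)"
  \<comment> \<open>The matrix of multiplication by \<open>z^r\<close>: column \<open>j\<close>
    holds index \<open>2k - 1 - j\<close>, so the entry of column \<open>j + r\<close> moves to
    column \<open>j\<close>. Its diagonal vanishes for \<open>r \<ge> 1\<close>.\<close>
  let ?B = "\<lambda>t j. if t = j + r then 1 else 0 :: real"
  have row: "(\<Sum>t<2*k. ?A i t * ?B t j) = exp_coeff (half_sign k i) (2*k - 1 - j) (n i + r)"
    if "j < 2*k" for i j
  proof -
    have "(\<Sum>t<2*k. ?A i t * ?B t j) = (\<Sum>t<2*k. if t = j + r then ?A i t else 0)"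
      by (intro sum.cong) auto
    also have "\<dots> = (if j + r < 2*k then ?A i (j + r) else 0)"
      by (subst sum.delta) auto
    also have "\<dots> = exp_coeff (half_sign k i) (2*k - 1 - j) (n i + r)"
      using that by (auto simp: exp_coeff_add diff_diff_left)
    finally show ?thesis .
  qed
  have "(\<Sum>i<2*k. exp_det k (shift i r n))
     = (\<Sum>i<2*k. Determinant.det (mat (2*k) (2*k) (\<lambda>(l, j). if l = i then \<Sum>t<2*k. ?A i t * ?B t j else ?A l j)))"
  proof (intro sum.cong refl)
    fix i assume "i \<in> {..<2*k}"
    then have i: "i < 2*k" by simp
    show "exp_det k (shift i r n)
      = Determinant.det (mat (2*k) (2*k) (\<lambda>(l, j). if l = i then \<Sum>t<2*k. ?A i t * ?B t j else ?A l j))"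
      unfolding exp_det_shift det_mat_row[OF i] by (intro sum.cong refl) (simp only: row lessThan_iff)
  qed
  also have "\<dots> = 0"
    unfolding sum_det_row_mult_eq_trace using assms by simp
  finally show ?thesis .
qed

lemma sum_euler_exp_det:
  "(\<Sum>i<2*k. real (n i) * exp_det k (shift i m n) + half_sign k i * exp_det k (shift i (Suc m) n))
   = (if m = 0 then real k * (2 * real k - 1) * exp_det k n else 0)"
proof -
  let ?A = "\<lambda>i j. exp_coeff (half_sign k i) (2*k - 1 - j) (n i)"
  \<comment> \<open>The matrix of \<open>z^(m + 1) d/dz\<close>: the coefficient of index
    \<open>2k - 1 - t\<close> is multiplied by that index and moved up by \<open>m\<close>.\<close>
  let ?B = "\<lambda>t j. if t = j + m then real (2*k - 1 - t) else 0"
  let ?r = "\<lambda>i s j. exp_coeff (half_sign k i) (2*k - 1 - j) (n i + s)"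
  have row: "(\<Sum>t<2*k. ?A i t * ?B t j) = real (n i) * ?r i m j + half_sign k i * ?r i (Suc m) j"
    if "j < 2*k" for i j
  proof -
    have "(\<Sum>t<2*k. ?A i t * ?B t j) = (\<Sum>t<2*k. if t = j + m then ?A i t * real (2*k - 1 - t) else 0)"
      by (intro sum.cong) auto
    also have "\<dots> = (if j + m < 2*k then ?A i (j + m) * real (2*k - 1 - (j + m)) else 0)"
      by (subst sum.delta) auto
    also have "\<dots> = real (n i) * ?r i m j + half_sign k i * ?r i (Suc m) j"
    proof (cases "j + m < 2*k")
      case True
      then have "m \<le> 2*k - 1 - j" by linarith
      from exp_coeff_deriv[OF this, of "half_sign k i" "n i"] True show ?thesis
        by (simp add: half_sign_def diff_diff_left mult.commute split: if_splits)
    next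
      case False
      with that show ?thesis by (auto simp: exp_coeff_def)
    qed
    finally show ?thesis .
  qed
  have "real (n i) * exp_det k (shift i m n) + half_sign k i * exp_det k (shift i (Suc m) n)
     = Determinant.det (mat (2*k) (2*k) (\<lambda>(l, j). if l = i then \<Sum>t<2*k. ?A i t * ?B t j else ?A l j))"
    if "i < 2*k" for i
  proof -
    let ?c = "cofactor (mat (2*k) (2*k) (\<lambda>(l, j). ?A l j)) i"
    have "real (n i) * exp_det k (shift i m n) + half_sign k i * exp_det k (shift i (Suc m) n)
       = (\<Sum>j<2*k. (real (n i) * ?r i m j + half_sign k i * ?r i (Suc m) j) * ?c j)"
      unfolding exp_det_shift det_mat_row[OF that] sum_distrib_left sum.distrib[symmetric]
      by (intro sum.cong refl) (simp only: distrib_right mult.assoc)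
    also have "\<dots> = (\<Sum>j<2*k. (\<Sum>t<2*k. ?A i t * ?B t j) * ?c j)"
      by (intro sum.cong refl) (simp only: row lessThan_iff)
    finally show ?thesis
      unfolding det_mat_row[OF that] .
  qed
  then have "(\<Sum>i<2*k. real (n i) * exp_det k (shift i m n) + half_sign k i * exp_det k (shift i (Suc m) n))
      = (\<Sum>i<2*k. Determinant.det (mat (2*k) (2*k) (\<lambda>(l, j). if l = i then \<Sum>t<2*k. ?A i t * ?B t j else ?A l j)))"
    by (intro sum.cong refl) (simp only: lessThan_iff)
  also have "\<dots> = (\<Sum>t<2*k. ?B t t) * exp_det k n"
    unfolding exp_det_def by (rule sum_det_row_mult_eq_trace)
  also have "(\<Sum>t<2*k. ?B t t) = (if m = 0 then real k * (2 * real k - 1) else 0)"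
  proof -
    have "(\<Sum>t<d. real (d - 1 - t)) = real d * (real d - 1) / 2" for d
    proof -
      have "(\<Sum>t<d. real (d - 1 - t)) = (\<Sum>t<d. real t)"
        using sum.nat_diff_reindex[of real d] by simp
      also have "\<dots> = real d * (real d - 1) / 2"
        by (induction d) (auto simp: field_simps)
      finally show ?thesis .
    qed
    from this[of "2*k"] show ?thesis by simp
  qed
  finally show ?thesis by (simp split: if_splits)
qed

lemma alternant_exp_det: "alternant k (exp_det k)"
proof
  have halves: "sum f {..<2*k} = sum f {..<k} + sum f {k..<2*k}" for f :: "nat \<Rightarrow> real"
    using sum.atLeastLessThan_concat[of 0 k "2*k" f] by (simp add: atLeast0LessThan)
  show "psum {..<k} r (exp_det k) n + psum {k..<2*k} r (exp_det k) n = 0" if "r \<ge> 1" for r n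
    using sum_shift_exp_det[OF that, of k n] by (simp only: psum_def halves)
  show "(\<Sum>i<2*k. real (n i) * exp_det k (shift i m n))
      + psum {..<k} (Suc m) (exp_det k) n - psum {k..<2*k} (Suc m) (exp_det k) n
      = (if m = 0 then real k * (2 * real k - 1) * exp_det k n else 0)" for n m
  proof -
    have "(\<Sum>i<2*k. half_sign k i * exp_det k (shift i (Suc m) n))
       = psum {..<k} (Suc m) (exp_det k) n - psum {k..<2*k} (Suc m) (exp_det k) n"
      unfolding halves by (simp add: psum_def half_sign_def sum_negf)
    then show ?thesis
      using sum_euler_exp_det[of n k m] by (simp only: sum.distrib)
  qed
qed (auto intro: alternating_on_exp_det)

section \<open>The determinant without shifts\<close>

lemma prod_list_diag_mat:
  "prod_list (diag_mat (mat d d f)) = (\<Prod>i<d. f (i, i))"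
  by (simp add: diag_mat_def prod.distinct_set_conv_list[symmetric] atLeast0LessThan)

text \<open>An LU factorisation: after row and column factors are extracted, the entry is
  \<open>(k + s) choose j\<close>, and Vandermonde's convolution splits it into a lower and an upper
  triangular factor.\<close>

lemma det_exp_coeff_2:
  "Determinant.det (mat k k (\<lambda>(s, j). exp_coeff 2 (2*k - 1 - j) (k - 1 - s)))
   = 2 ^ (k\<^sup>2) * (\<Prod>l<k. fact l / fact (k + l))"
proof -
  let ?L = "mat k k (\<lambda>(s, u). 2 ^ (k + s) / fact (k + s) * real (s choose u))"
  let ?U = "mat k k (\<lambda>(u, j). if u \<le> j then real (k choose (j - u)) * fact j / 2 ^ j else 0 :: real)"
  have "mat k k (\<lambda>(s, j). exp_coeff 2 (2*k - 1 - j) (k - 1 - s)) = ?L * ?U"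
  proof (rule eq_matI)
    fix s j assume "s < dim_row (?L * ?U)" "j < dim_col (?L * ?U)"
    then have sj: "s < k" "j < k" by auto
    have "(?L * ?U) $$ (s, j) = (\<Sum>u<k. 2 ^ (k + s) / fact (k + s) * real (s choose u)
             * (if u \<le> j then real (k choose (j - u)) * fact j / 2 ^ j else 0))"
      using sj by (simp add: scalar_prod_def atLeast0LessThan)
    also have "\<dots> = (\<Sum>u\<le>j. 2 ^ (k + s) / fact (k + s) * real (s choose u)
             * (real (k choose (j - u)) * fact j / 2 ^ j))"
      by (rule sum.mono_neutral_cong_right) (use sj in auto)
    also have "\<dots> = 2 ^ (k + s) / fact (k + s) * fact j / 2 ^ j
             * real (\<Sum>u\<le>j. (s choose u) * (k choose (j - u)))"
      by (simp add: sum_distrib_left sum_divide_distrib mult_ac)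
    also have "\<dots> = 2 ^ (k + s) / fact (k + s) * fact j / 2 ^ j * real ((s + k) choose j)"
      by (simp only: vandermonde)
    also have "\<dots> = 2 ^ (k + s - j) / fact (k + s - j)"
      using sj by (simp add: binomial_fact power_diff add.commute)
    also have "\<dots> = exp_coeff 2 (2*k - 1 - j) (k - 1 - s)"
    proof -
      have "2*k - 1 - j - (k - 1 - s) = k + s - j" "k - 1 - s \<le> 2*k - 1 - j"
        using sj by auto
      then show ?thesis by (simp add: exp_coeff_def)
    qed
    finally show "mat k k (\<lambda>(s, j). exp_coeff 2 (2*k - 1 - j) (k - 1 - s)) $$ (s, j) = (?L * ?U) $$ (s, j)"
      using sj by simp
  qed auto
  then have "Determinant.det (mat k k (\<lambda>(s, j). exp_coeff 2 (2*k - 1 - j) (k - 1 - s)))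
      = Determinant.det ?L * Determinant.det ?U"
    by (simp add: det_mult[of _ k])
  also have "Determinant.det ?L = (\<Prod>s<k. 2 ^ (k + s) / fact (k + s))"
    by (subst det_lower_triangular[of k]) (auto simp: prod_list_diag_mat)
  also have "Determinant.det ?U = (\<Prod>s<k. fact s / 2 ^ s :: real)"
    by (subst det_upper_triangular[of _ k]) (auto simp: prod_list_diag_mat)
  also have "(\<Prod>s<k. 2 ^ (k + s) / fact (k + s) :: real) * (\<Prod>s<k. fact s / 2 ^ s)
      = (\<Prod>s<k. 2 ^ k * (fact s / fact (k + s)))"
    unfolding prod.distrib[symmetric] by (intro prod.cong refl) (simp add: power_add)
  also have "\<dots> = 2 ^ (k\<^sup>2) * (\<Prod>l<k. fact l / fact (k + l))"
    unfolding prod.distrib by (simp add: power_mult[symmetric] power2_eq_square)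
  finally show ?thesis .
qed

text \<open>Multiplication by \<open>exp z\<close> is unimodular and turns the two halves of the matrix into the
  coefficients of \<open>z\<close>-powers times \<open>exp (2 z)\<close> and of plain powers of \<open>z\<close>.\<close>

lemma exp_det_staircase:
  "exp_det k (staircase k) = 2 ^ (k\<^sup>2) * (\<Prod>l<k. fact l / fact (k + l))"
proof -
  let ?d = "2*k"
  let ?e = "staircase k"
  let ?A = "mat ?d ?d (\<lambda>(i, j). exp_coeff (half_sign k i) (?d - 1 - j) (?e i))"
  let ?X = "mat ?d ?d (\<lambda>(t, j). exp_coeff 1 (?d - 1 - j) (?d - 1 - t))"
  let ?B = "mat k k (\<lambda>(i, j). exp_coeff 2 (?d - 1 - j) i)"
  let ?C = "mat k k (\<lambda>(i, j). exp_coeff 2 (k - 1 - j) i)"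
  let ?J = "mat k k (\<lambda>(i, j). if i = k - 1 - j then 1 else 0 :: real)"
  have "?A * ?X = four_block_mat ?B ?C (0\<^sub>m k k) ?J"
  proof (rule eq_matI)
    fix i j assume "i < dim_row (four_block_mat ?B ?C (0\<^sub>m k k) ?J)"
      "j < dim_col (four_block_mat ?B ?C (0\<^sub>m k k) ?J)"
    then have ij: "i < ?d" "j < ?d" by auto
    have "(?A * ?X) $$ (i, j)
       = (\<Sum>t<?d. exp_coeff (half_sign k i) (?d - 1 - t) (?e i) * exp_coeff 1 (?d - 1 - j) (?d - 1 - t))"
      using ij by (simp add: scalar_prod_def atLeast0LessThan)
    also have "\<dots> = (\<Sum>t<?d. exp_coeff (half_sign k i) t (?e i) * exp_coeff 1 (?d - 1 - j) t)"
      by (rule sum.reindex_bij_witness[of _ "\<lambda>t. ?d - 1 - t" "\<lambda>t. ?d - 1 - t"]) auto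
    also have "\<dots> = exp_coeff (half_sign k i + 1) (?d - 1 - j) (?e i)"
      by (rule sum_exp_coeff_mult) (use ij in auto)
    \<comment> \<open>On the lower half the exponential has become \<open>exp 0\<close>; since
      \<open>0 ^ 0 = 1\<close>, a row keeps just the entry whose index equals its power.\<close>
    also have "\<dots> = four_block_mat ?B ?C (0\<^sub>m k k) ?J $$ (i, j)"
    proof -
      have "?d - 1 - j = k - 1 - (j - k)" if "j \<ge> k" using that ij by auto
      then show ?thesis
        using ij by (auto simp: half_sign_def exp_coeff_def power_0_left)
    qed
    finally show "(?A * ?X) $$ (i, j) = four_block_mat ?B ?C (0\<^sub>m k k) ?J $$ (i, j)" .
  qed auto
  then have "Determinant.det ?A * Determinant.det ?X = Determinant.det ?B * Determinant.det ?J"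
    using det_four_block_mat_lower_left_zero[of ?B k ?C k "0\<^sub>m k k" ?J] det_mult[of ?A ?d ?X] by simp
  also have "Determinant.det ?X = 1"
    by (subst det_lower_triangular[of ?d]) (auto simp: prod_list_diag_mat exp_coeff_def)
  \<comment> \<open>The sign of \<open>Determinant.det ?J\<close> is never evaluated:
    \<open>?J\<close> reverses the rows of \<open>?B\<close>, which gives the matrix of
    \<open>det_exp_coeff_2\<close>.\<close>
  also have "Determinant.det ?B * Determinant.det ?J = Determinant.det (?J * ?B)"
    by (simp add: det_mult[of _ k])
  also have "?J * ?B = mat k k (\<lambda>(s, j). exp_coeff 2 (?d - 1 - j) (k - 1 - s))"
  proof (rule eq_matI)
    fix s j assume "s < dim_row (mat k k (\<lambda>(s, j). exp_coeff 2 (?d - 1 - j) (k - 1 - s)))"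
      "j < dim_col (mat k k (\<lambda>(s, j). exp_coeff 2 (?d - 1 - j) (k - 1 - s)))"
    then have sj: "s < k" "j < k" by auto
    have "(?J * ?B) $$ (s, j) = (\<Sum>i<k. (if s = k - 1 - i then 1 else 0) * exp_coeff 2 (?d - 1 - j) i)"
      using sj by (simp add: scalar_prod_def atLeast0LessThan)
    also have "\<dots> = (\<Sum>i<k. if i = k - 1 - s then exp_coeff 2 (?d - 1 - j) i else 0)"
      by (intro sum.cong) (use sj in auto)
    finally show "(?J * ?B) $$ (s, j) = mat k k (\<lambda>(s, j). exp_coeff 2 (?d - 1 - j) (k - 1 - s)) $$ (s, j)"
      using sj by simp
  qed auto
  finally show ?thesis unfolding exp_det_def det_exp_coeff_2 by simp
qed

section \<open>Polynomiality\<close>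

text \<open>\<open>d\<close> stands for weight, each unit of which allows two degrees in
  \<open>k\<close>. The unshifted determinant stays as a factor, to be cancelled by the
  normalisation.\<close>

definition poly_multiple :: "nat \<Rightarrow> (nat \<Rightarrow> real) \<Rightarrow> bool" where
  "poly_multiple d X \<longleftrightarrow> (\<exists>p. degree p \<le> 2 * d \<and>
     (\<forall>k. X k = poly p (real k) * exp_det k (staircase k)))"

lemma poly_multiple_mono: "poly_multiple d X \<Longrightarrow> d \<le> e \<Longrightarrow> poly_multiple e X"
  unfolding poly_multiple_def by (meson le_trans mult_le_mono2)

lemma poly_multiple_add:
  assumes "poly_multiple d X" "poly_multiple d Y"
  shows "poly_multiple d (\<lambda>k. X k + Y k)"
proof -
  from assms obtain p q where "degree p \<le> 2 * d" "degree q \<le> 2 * d"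
    "\<And>k. X k = poly p (real k) * exp_det k (staircase k)"
    "\<And>k. Y k = poly q (real k) * exp_det k (staircase k)"
    unfolding poly_multiple_def by blast
  then show ?thesis
    unfolding poly_multiple_def
    by (intro exI[of _ "p + q"]) (simp add: degree_add_le distrib_right)
qed

lemma poly_multiple_scale:
  assumes "poly_multiple d X"
  shows "poly_multiple d (\<lambda>k. c * X k)"
proof -
  from assms obtain p where "degree p \<le> 2 * d"
    "\<And>k. X k = poly p (real k) * exp_det k (staircase k)"
    unfolding poly_multiple_def by blast
  then show ?thesis
    unfolding poly_multiple_def
    by (intro exI[of _ "smult c p"]) (simp add: le_trans[OF degree_smult_le])
qed

lemma poly_multiple_uminus: "poly_multiple d X \<Longrightarrow> poly_multiple d (\<lambda>k. - X k)"
  using poly_multiple_scale[of d X "-1"] by simp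

lemma poly_multiple_diff:
  "poly_multiple d X \<Longrightarrow> poly_multiple d Y \<Longrightarrow> poly_multiple d (\<lambda>k. X k - Y k)"
  using poly_multiple_add[of d X "\<lambda>k. - Y k"] poly_multiple_uminus[of d Y] by simp

lemma poly_multiple_sum:
  assumes "\<And>t. t \<in> T \<Longrightarrow> poly_multiple d (X t)"
  shows "poly_multiple d (\<lambda>k. \<Sum>t\<in>T. X t k)"
  using assms
proof (induction T rule: infinite_finite_induct)
  case (insert t T)
  then show ?case by (simp add: poly_multiple_add)
qed (auto simp: poly_multiple_def intro: exI[of _ 0])

lemma poly_multiple_square_minus:
  assumes "poly_multiple d X"
  shows "poly_multiple (Suc d) (\<lambda>k. ((real k)\<^sup>2 - c) * X k)"
proof -
  from assms obtain p where p: "degree p \<le> 2 * d"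
    "\<And>k. X k = poly p (real k) * exp_det k (staircase k)"
    unfolding poly_multiple_def by blast
  have "degree ([:- c, 0, 1:] * p) \<le> 2 * Suc d"
    by (rule order.trans[OF degree_mult_le]) (use p(1) in simp)
  then show ?thesis
    unfolding poly_multiple_def
    by (intro exI[of _ "[:- c, 0, 1:] * p"]) (simp add: p(2) power2_eq_square algebra_simps)
qed

lemma sum_list_update_add:
  "t < length ls \<Longrightarrow> sum_list (ls[t := ls ! t + m]) = sum_list ls + (m :: nat)"
  using elem_le_sum_list[of t ls] by (simp add: sum_list_update)

lemma zero_notin_update_add:
  "0 \<notin> set ls \<Longrightarrow> t < length ls \<Longrightarrow> 0 \<notin> set (ls[t := ls ! t + (m :: nat)])"
  by (auto simp: in_set_conv_nth nth_list_update)

text \<open>Induction on the weight through the loop equations. A leading part 1 costs one unit of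
  weight and yields a factor quadratic in \<open>k\<close>; a larger leading part leads to lists of
  weight one less, with positive parts and coefficients free of \<open>k\<close>.\<close>

lemma poly_multiple_pw:
  assumes "0 \<notin> set ls"
  shows "poly_multiple (sum_list ls) (\<lambda>k. pw {..<k} ls (exp_det k) (staircase k))"
  using assms
proof (induction "sum_list ls" arbitrary: ls rule: less_induct)
  case less
  show ?case
  proof (cases ls)
    case Nil
    then show ?thesis by (auto simp: poly_multiple_def intro: exI[of _ 1])
  next
    case (Cons r xs)
    with less.prems have r: "r \<ge> 1" "0 \<notin> set xs" by auto
    show ?thesis
    proof (cases "r = 1")
      case True
      have IH: "poly_multiple (sum_list xs) (\<lambda>k. pw {..<k} xs (exp_det k) (staircase k))"
        using less.hyps[of xs] True r Cons by simp
      show ?thesis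
        using poly_multiple_scale[OF poly_multiple_square_minus[OF IH, of "real (sum_list xs)"], of "1/2"]
        by (simp add: Cons True alternant.pw_Cons_1[OF alternant_exp_det] del: foldr.simps)
    next
      case False
      with r obtain m where m: "r = Suc m" "m \<ge> 1" by (cases r) auto
      have "poly_multiple (m + sum_list xs) (\<lambda>k. pw {..<k} (a # (m - a) # xs) (exp_det k) (staircase k))"
        if "a \<in> {1..<m}" for a
        by (rule poly_multiple_mono[OF less.hyps]) (use that r Cons m in auto)
      moreover have "poly_multiple (m + sum_list xs) (\<lambda>k. pw {..<k} (xs[t := xs ! t + m]) (exp_det k) (staircase k))"
        if "t < length xs" for t
        by (rule poly_multiple_mono[OF less.hyps[OF _ zero_notin_update_add]])
           (use that r Cons m in \<open>auto simp: sum_list_update_add\<close>)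
      ultimately have "poly_multiple (m + sum_list xs) (\<lambda>k. - 1 / 2 *
          ((\<Sum>a\<in>{1..<m}. pw {..<k} (a # (m - a) # xs) (exp_det k) (staircase k))
           + (\<Sum>t<length xs. real (xs ! t) * pw {..<k} (xs[t := xs ! t + m]) (exp_det k) (staircase k))))"
        by (intro poly_multiple_scale poly_multiple_add poly_multiple_sum) auto
      then have "poly_multiple (sum_list ls) (\<lambda>k. - 1 / 2 *
          ((\<Sum>a\<in>{1..<m}. pw {..<k} (a # (m - a) # xs) (exp_det k) (staircase k))
           + (\<Sum>t<length xs. real (xs ! t) * pw {..<k} (xs[t := xs ! t + m]) (exp_det k) (staircase k))))"
        by (rule poly_multiple_mono) (simp add: Cons m)
      then show ?thesis
        by (simp only: Cons m(1) alternant.pw_Cons_Suc[OF alternant_exp_det m(2)])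
    qed
  qed
qed

text \<open>\<open>inj_sum_Cons\<close> shortens \<open>xs\<close>: its first part becomes a power
  sum or is merged into another part. The total weight is constant, so the degree bound
  survives.\<close>

lemma poly_multiple_inj_sum:
  assumes "0 \<notin> set xs" "0 \<notin> set ls"
  shows "poly_multiple (sum_list xs + sum_list ls)
    (\<lambda>k. inj_sum {..<k} xs (pw {..<k} ls (exp_det k)) (staircase k))"
  using assms
proof (induction "length xs" arbitrary: xs ls)
  case 0
  then show ?case by (simp add: poly_multiple_pw)
next
  case (Suc l)
  then obtain r ys where xs: "xs = r # ys" by (cases xs) auto
  have "poly_multiple (sum_list xs + sum_list ls)
      (\<lambda>k. inj_sum {..<k} ys (pw {..<k} (r # ls) (exp_det k)) (staircase k))"
    by (rule poly_multiple_mono[OF Suc.hyps(1)]) (use Suc.prems Suc.hyps(2) xs in auto)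
  moreover have "poly_multiple (sum_list xs + sum_list ls)
      (\<lambda>k. inj_sum {..<k} (ys[t := ys ! t + r]) (pw {..<k} ls (exp_det k)) (staircase k))"
    if "t < length ys" for t
    by (rule poly_multiple_mono[OF Suc.hyps(1)[OF _ zero_notin_update_add]])
       (use Suc.prems Suc.hyps(2) xs that in \<open>auto simp: sum_list_update_add\<close>)
  ultimately have "poly_multiple (sum_list xs + sum_list ls)
    (\<lambda>k. inj_sum {..<k} ys (pw {..<k} (r # ls) (exp_det k)) (staircase k)
        - (\<Sum>t<length ys. inj_sum {..<k} (ys[t := ys ! t + r]) (pw {..<k} ls (exp_det k)) (staircase k)))"
    by (intro poly_multiple_diff poly_multiple_sum) auto
  then show ?case by (simp add: xs inj_sum_Cons)
qed

text \<open>Parts on the second half are peeled off first. Each power sum arising there becomes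
  minus one on the first half by \<open>psum_Q_pw\<close> and joins \<open>ls\<close>, until only
  the first half remains.\<close>

lemma poly_multiple_inj_sum_inj_sum:
  assumes "0 \<notin> set xs" "0 \<notin> set zs" "0 \<notin> set ls"
  shows "poly_multiple (sum_list xs + sum_list zs + sum_list ls)
    (\<lambda>k. inj_sum {..<k} xs (inj_sum {k..<2*k} zs (pw {..<k} ls (exp_det k))) (staircase k))"
  using assms
proof (induction "length zs" arbitrary: zs ls)
  case 0
  then show ?case by (simp add: poly_multiple_inj_sum)
next
  case (Suc l)
  then obtain r ys where zs: "zs = r # ys" by (cases zs) auto
  let ?F = "\<lambda>k zs ls. inj_sum {..<k} xs (inj_sum {k..<2*k} zs (pw {..<k} ls (exp_det k))) (staircase k)"
  have "poly_multiple (sum_list xs + sum_list zs + sum_list ls) (\<lambda>k. ?F k ys (r # ls))"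
    by (rule poly_multiple_mono[OF Suc.hyps(1)]) (use Suc.prems Suc.hyps(2) zs in auto)
  moreover have "poly_multiple (sum_list xs + sum_list zs + sum_list ls)
      (\<lambda>k. ?F k (ys[t := ys ! t + r]) ls)" if "t < length ys" for t
    by (rule poly_multiple_mono[OF Suc.hyps(1)[OF _ _ zero_notin_update_add]])
       (use Suc.prems Suc.hyps(2) zs that in \<open>auto simp: sum_list_update_add\<close>)
  ultimately have "poly_multiple (sum_list xs + sum_list zs + sum_list ls)
      (\<lambda>k. - ?F k ys (r # ls) - (\<Sum>t<length ys. ?F k (ys[t := ys ! t + r]) ls))"
    by (intro poly_multiple_diff poly_multiple_sum poly_multiple_uminus) auto
  moreover have "?F k zs ls = - ?F k ys (r # ls) - (\<Sum>t<length ys. ?F k (ys[t := ys ! t + r]) ls)" for k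
  proof -
    let ?Q = "{k..<2*k}" and ?\<Phi> = "pw {..<k} ls (exp_det k)"
    have "psum ?Q r ?\<Phi> = (\<lambda>n. - pw {..<k} (r # ls) (exp_det k) n)"
      using Suc.prems zs by (intro alternant.psum_Q_pw[OF alternant_exp_det]) auto
    moreover have "inj_sum ?Q zs ?\<Phi> = (\<lambda>n. inj_sum ?Q ys (psum ?Q r ?\<Phi>) n
        - (\<Sum>t<length ys. inj_sum ?Q (ys[t := ys ! t + r]) ?\<Phi> n))"
      by (rule ext) (simp only: zs inj_sum_Cons[OF finite_atLeastLessThan])
    ultimately have "inj_sum ?Q zs ?\<Phi> = (\<lambda>n. - inj_sum ?Q ys (pw {..<k} (r # ls) (exp_det k)) n
        - (\<Sum>t<length ys. inj_sum ?Q (ys[t := ys ! t + r]) ?\<Phi> n))"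
      by (simp only: inj_sum_uminus)
    then show ?thesis
      by (simp only: inj_sum_diff inj_sum_uminus inj_sum_sum)
  qed
  ultimately show ?case by simp
qed

section \<open>From the Gamma matrix to the exponential determinant\<close>

text \<open>For \<open>n > c\<close> the argument is a pole of Gamma, and the value 0 of
  \<open>rGamma\<close> there matches the default of \<open>exp_coeff\<close>.\<close>

lemma rGamma_of_int_eq_exp_coeff:
  "rGamma (of_int (int c - int n + 1) :: real) = exp_coeff 1 c n"
proof (cases "n \<le> c")
  case True
  then have "rGamma (of_int (int c - int n + 1) :: real) = rGamma (1 + real (c - n))"
    by (simp add: of_nat_diff add.commute)
  also have "\<dots> = 1 / fact (c - n)"
    using Gamma_fact[of "c - n", where 'a = real] by (simp add: rGamma_inverse_Gamma divide_inverse)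
  finally show ?thesis using True by (simp add: exp_coeff_def)
next
  case False
  then have "(of_int (int c - int n + 1) :: real) \<in> \<int>\<^sub>\<le>\<^sub>0"
    by (intro nonpos_Ints_of_int) auto
  then have "rGamma (of_int (int c - int n + 1) :: real) = 0"
    by (simp only: rGamma_eq_zero_iff)
  then show ?thesis using False by (simp add: exp_coeff_def)
qed

lemma det_mult_rows:
  fixes A :: "real mat"
  assumes "A \<in> carrier_mat d d"
  shows "Determinant.det (mat d d (\<lambda>(i, j). c i * A $$ (i, j))) = (\<Prod>i<d. c i) * Determinant.det A"
proof -
  let ?D = "mat d d (\<lambda>(i, j). if i = j then c i else 0)"
  have "mat d d (\<lambda>(i, j). c i * A $$ (i, j)) = ?D * A"
  proof (rule eq_matI)
    fix i j assume "i < dim_row (?D * A)" "j < dim_col (?D * A)"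
    then have ij: "i < d" "j < d" using assms by auto
    have "(?D * A) $$ (i, j) = (\<Sum>t<d. (if i = t then c i else 0) * A $$ (t, j))"
      using assms ij by (simp add: scalar_prod_def atLeast0LessThan)
    also have "\<dots> = (\<Sum>t<d. if i = t then c i * A $$ (t, j) else 0)"
      by (intro sum.cong) auto
    finally show "mat d d (\<lambda>(i, j). c i * A $$ (i, j)) $$ (i, j) = (?D * A) $$ (i, j)"
      using ij by simp
  qed (use assms in auto)
  also have "Determinant.det \<dots> = Determinant.det ?D * Determinant.det A"
    by (rule det_mult[of _ d]) (use assms in auto)
  also have "Determinant.det ?D = (\<Prod>i<d. c i)"
    by (subst det_lower_triangular[of d]) (auto simp: prod_list_diag_mat)
  finally show ?thesis .
qed

text \<open>The global sign is distributed over the lower rows, where together with the checkerboard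
  sign it turns the coefficients of \<open>exp z\<close> into those of
  \<open>exp (-z)\<close>.\<close>

lemma Mtilde_eq_exp_det:
  assumes "length s = k" "length t = k"
  shows "Mtilde k s t = exp_det k (add_at k (zero_extend t) (add_at 0 (zero_extend s) (staircase k)))"
proof -
  let ?n = "add_at k (zero_extend t) (add_at 0 (zero_extend s) (staircase k))"
  let ?c = "\<lambda>i. if i < k then 1 else (-1) ^ (t ! (i - k)) :: real"
  have n: "?n i = (if i < k then i + s ! i else (i - k) + t ! (i - k))" if "i < 2*k" for i
    using that assms by (auto simp: add_at_def zero_extend_def)
  have "(\<lambda>(i, j). ?c i * Mmat k s t $$ (i, j)) (i, j) = exp_coeff (half_sign k i) (2*k - 1 - j) (?n i)"
    if ij: "i < 2*k" "j < 2*k" for i j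
  proof (cases "i < k")
    case True
    have arg: "2 * int k - int (i+1) - int (j+1) + 2 - int (s ! i)
        = int (2*k - 1 - j) - int (i + s ! i) + 1" using ij by auto
    have "Mmat k s t $$ (i, j) = exp_coeff 1 (2*k - 1 - j) (i + s ! i)"
      unfolding rGamma_of_int_eq_exp_coeff[symmetric] arg[symmetric] using True ij by (simp add: Mmat_def)
    then show ?thesis
      using True ij by (simp add: n half_sign_def)
  next
    case False
    let ?c' = "2*k - 1 - j" and ?m = "(i - k) + t ! (i - k)"
    have arg: "2 * int k - int (i-k+1) - int (j+1) + 2 - int (t ! (i-k))
        = int ?c' - int ?m + 1" using ij by auto
    have "(-1) ^ (t ! (i - k)) * ((-1) ^ ((i-k+1) + (j+1) - 1) * exp_coeff 1 ?c' ?m)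
        = exp_coeff (-1) ?c' ?m"
    proof (cases "?m \<le> ?c'")
      case True
      have par: "even (t ! (i - k) + ((i-k+1) + (j+1) - 1)) \<longleftrightarrow> even (?c' - ?m)"
      proof -
        \<comment> \<open>Both sign exponents and the degree \<open>?c' - ?m\<close> add up to an
          even number, so the signs combine to \<open>(-1) ^ (?c' - ?m)\<close>.\<close>
        have "(t ! (i - k) + ((i-k+1) + (j+1) - 1)) + (?c' - ?m) = 2*k"
          using True ij by linarith
        then have "even ((t ! (i - k) + ((i-k+1) + (j+1) - 1)) + (?c' - ?m))" by (simp only: even_mult_iff even_numeral simp_thms)
        then show ?thesis by (simp only: even_add)
      qed
      have "(-1) ^ (t ! (i - k)) * ((-1) ^ ((i-k+1) + (j+1) - 1) * exp_coeff 1 ?c' ?m)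
          = (-1) ^ (t ! (i - k) + ((i-k+1) + (j+1) - 1)) * exp_coeff 1 ?c' ?m"
        by (simp only: power_add mult.assoc)
      also have "\<dots> = (-1) ^ (?c' - ?m) * exp_coeff 1 ?c' ?m"
        by (simp only: minus_one_power_iff par)
      also have "\<dots> = exp_coeff (-1) ?c' ?m"
        using True by (simp add: exp_coeff_def)
      finally show ?thesis .
    qed (auto simp: exp_coeff_def)
    moreover have "Mmat k s t $$ (i, j) = (-1) ^ ((i-k+1) + (j+1) - 1) * exp_coeff 1 ?c' ?m"
      unfolding rGamma_of_int_eq_exp_coeff[symmetric] arg[symmetric] using False ij by (simp add: Mmat_def)
    ultimately show ?thesis
      using False ij by (simp add: n half_sign_def)
  qed
  then have "exp_det k ?n = Determinant.det (mat (2*k) (2*k) (\<lambda>(i, j). ?c i * Mmat k s t $$ (i, j)))"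
    unfolding exp_det_def by (intro arg_cong[of _ _ Determinant.det] eq_matI) auto
  also have "\<dots> = (\<Prod>i<2*k. ?c i) * Determinant.det (Mmat k s t)"
    by (rule det_mult_rows) (simp add: Mmat_def)
  also have "(\<Prod>i<2*k. ?c i) = (-1) ^ sum_list t"
  proof -
    have "(\<Prod>i<2*k. ?c i) = (\<Prod>i<k. ?c i) * (\<Prod>i\<in>{k..<2*k}. ?c i)"
      using prod.atLeastLessThan_concat[of 0 k "2*k" ?c] by (simp add: atLeast0LessThan)
    also have "\<dots> = (\<Prod>i<k. (-1) ^ (t ! i))"
      using prod.atLeastLessThan_shift_0[of ?c k "2*k"] by (simp add: atLeast0LessThan)
    also have "\<dots> = (-1) ^ sum_list t"
      by (simp add: power_sum[symmetric] sum_list_sum_nth assms(2) atLeast0LessThan)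
    finally show ?thesis .
  qed
  finally show ?thesis by (simp add: Mtilde_def)
qed

theorem theorem2:
  fixes \<alpha> \<beta> :: "nat list"
  assumes "is_partition \<alpha>" and "is_partition \<beta>"
  shows "\<exists>p :: real poly. degree p \<le> 2 * (sum_list \<alpha> + sum_list \<beta>) \<and>
           (\<forall>k::nat. k \<ge> length \<alpha> \<and> k \<ge> length \<beta> \<longrightarrow> N k \<alpha> \<beta> = poly p (real k))"
proof -
  have pos: "0 \<notin> set \<alpha>" "0 \<notin> set \<beta>" using assms by (auto simp: is_partition_def)
  define r where "r = sum_list \<alpha> + sum_list \<beta>"
  define C where "C = (\<lambda>ls. real (card (placements ls (zero_extend ls))))"
  have C: "C \<alpha> > 0" "C \<beta> > 0" using pos by (auto simp: C_def card_placements_pos)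
  obtain p where p: "degree p \<le> 2 * r"
    "\<And>k. inj_sum {..<k} \<alpha> (inj_sum {k..<2*k} \<beta> (exp_det k)) (staircase k)
       = poly p (real k) * exp_det k (staircase k)"
    using poly_multiple_inj_sum_inj_sum[OF pos, of "[]"] by (auto simp: poly_multiple_def r_def)
  \<comment> \<open>The factor \<open>2 ^ (k\<^sup>2)\<close> and the product of factorials in the
    unshifted determinant cancel against the prefactor of \<open>N\<close>, leaving
    \<open>2 ^ r\<close>; \<open>C\<close> removes the multiplicities of the rearrangements.\<close>
  define q where "q = smult (2 ^ r / (C \<alpha> * C \<beta>)) p"
  have "N k \<alpha> \<beta> = poly q (real k)" if k: "k \<ge> length \<alpha>" "k \<ge> length \<beta>" for k
  proof -
    let ?A = "\<lambda>ls. permutations_of_multiset (mset (pad k ls))"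
    let ?\<Pi> = "\<Prod>l<k. fact l / fact (k + l) :: real"
    define S where "S = (\<Sum>s\<in>?A \<alpha>. \<Sum>t\<in>?A \<beta>. Mtilde k s t)"
    have len: "length s = k" if "s \<in> ?A ls" "length ls \<le> k" for s ls
      using that mset_eq_length[of s "pad k ls"] by (auto simp: permutations_of_multiset_def pad_def)
    have P: "inj_sum {..<k} \<alpha> F n = C \<alpha> * (\<Sum>s\<in>?A \<alpha>. F (add_at 0 (zero_extend s) n))" for F n
      using inj_sum_eq_sum_permutations[OF pos(1) k(1), of 0] by (simp add: C_def atLeast0LessThan)
    have Q: "inj_sum {k..<2*k} \<beta> F n = C \<beta> * (\<Sum>s\<in>?A \<beta>. F (add_at k (zero_extend s) n))" for F n
      using inj_sum_eq_sum_permutations[OF pos(2) k(2), of k] by (simp add: C_def mult_2)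
    have "C \<alpha> * C \<beta> * S = inj_sum {..<k} \<alpha> (inj_sum {k..<2*k} \<beta> (exp_det k)) (staircase k)"
      unfolding P Q S_def sum_distrib_left mult.assoc
      by (intro sum.cong refl) (simp only: Mtilde_eq_exp_det len k)
    also have "\<dots> = poly p (real k) * (2 ^ (k\<^sup>2) * ?\<Pi>)"
      by (simp only: p(2) exp_det_staircase)
    finally have S: "S = poly p (real k) * (2 ^ (k\<^sup>2) * ?\<Pi>) / (C \<alpha> * C \<beta>)"
      using C by (simp add: field_simps)
    have "?\<Pi> \<noteq> 0" by simp
    moreover have "1 / (2::real) powi (int (k\<^sup>2) - int r) = 2 ^ r / 2 ^ (k\<^sup>2)"
      by (simp add: power_int_diff del: of_nat_power)
    moreover have "N k \<alpha> \<beta> = 1 / (2::real) powi (int (k\<^sup>2) - int r) * inverse ?\<Pi> * S"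
      by (simp only: N_def Let_def r_def S_def)
    ultimately show ?thesis
      unfolding S q_def by (simp add: field_simps del: prod_dividef)
  qed
  moreover have "degree q \<le> 2 * r"
    unfolding q_def using p(1) by (rule le_trans[OF degree_smult_le])
  ultimately show ?thesis unfolding r_def by blast
qed

end
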